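(* Let $d\in\mathbb N$, $d\ge2$, let $X$ be a random vector with values in $\mathbb R^d$ with $\mathrm E(|X|^2)<\infty$, expectation vector $\mu=\mathrm E(X)$ and positive definite covariance matrix $\Sigma=\mathrm{Cov}(X)$. Let $I$ be a random vector with values in $\{0,1\}^d$, independent of $X$, with probability mass function $p(a)=P(I=a)$ satisfying $p(\mathbf 1_d)>0$, where $\mathbf 1_d=(1,\dots,1)$. Let $(I_i,I_i\odot X_i)$, $i=1,\dots,n$, be independent with the same distribution as $(I,I\odot X)$, and let $\widehat\mu_n$, $\widehat\Sigma_n$, $\widehat p_n$ be estimators (measurable functions of this sample), with values in $\mathbb R^d$, in the symmetric positive semidefinite $d\times d$ matrices and in the probability mass functions on $\{0,1\}^d$, respectively, such that as $n\to\infty$ we have $\widehat\mu_n\to\mu$ a.s., $\widehat\Sigma_n\to\Sigma$ a.s. and $\widehat p_n(a)\to p(a)$ a.s. for all $a\in\{0,1\}^d$. Let $T_n$ be the test statistic and $\varphi_\pi,\phi_\pi$ the functions defined in the context. Then $$\frac1n T_n\longrightarrow\kappa\quad\text{almost surely as }n\to\infty,\qquad\text{where}\qquad \kappa=\sum_{\pi\in\Pi}w_\pi\int|\varphi_\pi-\phi_\pi|^2\,\mathrm d\Phi_{d_\pi}.$$ Moreover $\kappa\in[0,\infty)$, with $\kappa=0$ under the null hypothesis $H_0$ and $\kappa>0$ under the alternative $H_1$.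
   Context: Hypotheses: $H_0$ states that $\mathcal L(X)\in\mathfrak L_X$ and $H_1$ that $\mathcal L(X)\notin\mathfrak L_X$, where $\mathfrak L_X$ is the family of all normal distributions $\mathcal N_d(m,S)$ with $m\in\mathbb R^d$ and $S\in\mathbb R^{d\times d}$ symmetric positive definite. Notation: $\odot$ is the Hadamard (entrywise) product, $\langle\cdot,\cdot\rangle$ the standard scalar product, $|\cdot|$ the Euclidean norm (complex modulus for complex numbers), and $i$ in exponentials denotes the imaginary unit. $\Pi$ is the set of all coordinate projections $\pi:\mathbb R^d\to\mathbb R^{d_\pi}$, $\pi(x)=(x(i_1),\dots,x(i_{d_\pi}))^\top$, with $1\le i_1<\dots<i_{d_\pi}\le d$ and $1\le d_\pi\le d$. For a $d\times d$ matrix $A$, $\pi(A)$ is the $d_\pi\times d_\pi$ submatrix with rows and columns $i_1,\dots,i_{d_\pi}$ (so $\pi(\Sigma)$ is the covariance matrix of $\pi(X)$). For a probability mass function $q$ on $\{0,1\}^d$, $\pi(q)$ is the image mass function, $\pi(q)(a)=\sum_{b\in\{0,1\}^d:\,\pi(b)=a}q(b)$, $a\in\{0,1\}^{d_\pi}$. For $a\in\{0,1\}^{d_\pi}$, $D_a=\mathrm{diag}(a)$. $\Phi_{d_\pi}$ is the standard normal distribution on $\mathbb R^{d_\pi}$. For $\pi\in\Pi$ and $t\in\mathbb R^{d_\pi}$ let $$\varphi_\pi(t)=\mathrm E\big(\exp(i\langle t,\pi(I\odot(X-\mu))\rangle)\big),$$ $$\phi_\pi(t)=\sum_{a\in\{0,1\}^{d_\pi}}\exp\big(-\tfrac12\langle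 D_a\pi(\Sigma)D_at,t\rangle\big)\,\pi(p)(a),$$ $$\widehat\varphi_{n,\pi}(t)=\frac1n\sum_{k=1}^n\exp\big(i\langle t,\pi(I_k\odot(X_k-\widehat\mu_n))\rangle\big),$$ $$\widehat\phi_{n,\pi}(t)=\sum_{a\in\{0,1\}^{d_\pi}}\exp\big(-\tfrac12\langle D_a\pi(\widehat\Sigma_n)D_at,t\rangle\big)\,\pi(\widehat p_n)(a).$$ The test statistic is $$T_n=\sum_{\pi\in\Pi}w_\pi T_{n,\pi},\qquad T_{n,\pi}=n\int|\widehat\varphi_{n,\pi}-\widehat\phi_{n,\pi}|^2\,\mathrm d\Phi_{d_\pi},$$ with fixed weights $w_\pi\in[0,1]$, $\sum_{\pi\in\Pi}w_\pi=1$ and $w_{\mathrm{id}}>0$, where $\mathrm{id}\in\Pi$ is the identity map on $\mathbb R^d$. *)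

theory Defs
  imports "HOL-Probability.Probability"
begin

text \<open>
  Column vectors of size $d$ are elements of \<open>real ^ 'd\<close> (abbreviated below so that \<open>'d\<close> may carry an
  order); the linear order on the index type plays the role of the order of $1, \dots, d$.  The
  target spaces of the coordinate projections have varying dimension $k$, so their elements are
  extensional functions on \<open>{..<k}\<close> (coordinates counted from 0), and $k \times k$ matrices are
  functions \<open>nat \<Rightarrow> nat \<Rightarrow> real\<close> of which only the entries with indices below $k$ are used.  On
  \<open>real ^ 'd\<close> the product \<open>(*)\<close> is the entrywise (Hadamard) product and \<open>1\<close> is the all-ones
  vector.
\<close>

type_synonym 'd rvec = "(real, 'd) vec"

type_synonym 'd rmat = "((real, 'd) vec, 'd) vec"

definition pos_semidef :: "('d :: finite) rmat \<Rightarrow> bool" where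
  "pos_semidef S \<longleftrightarrow> transpose S = S \<and> (\<forall>x. 0 \<le> (S *v x) \<bullet> x)"

definition pos_def :: "('d :: finite) rmat \<Rightarrow> bool" where
  "pos_def S \<longleftrightarrow> transpose S = S \<and> (\<forall>x. x \<noteq> 0 \<longrightarrow> 0 < (S *v x) \<bullet> x)"

definition cov_matrix :: "'a measure \<Rightarrow> ('a \<Rightarrow> ('d :: finite) rvec) \<Rightarrow> 'd rmat" where
  "cov_matrix M X = (\<chi> i j. \<integral>\<omega>. (X \<omega> $ i - (\<integral>\<omega>'. X \<omega>' \<partial>M) $ i) * (X \<omega> $ j - (\<integral>\<omega>'. X \<omega>' \<partial>M) $ j) \<partial>M)"

definition normal_law :: "('d :: finite) rvec \<Rightarrow> 'd rmat \<Rightarrow> 'd rvec measure" where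
  "normal_law m S = density lborel (\<lambda>x. ennreal
     (exp (- (1 / 2) * ((matrix_inv S *v (x - m)) \<bullet> (x - m))) / sqrt ((2 * pi) ^ CARD('d) * det S)))"

definition normal_family :: "('d :: finite) rvec measure set" where
  "normal_family = {normal_law m S | m S. pos_def S}"

definition cube :: "('d :: finite) rvec set" where
  "cube = {a. \<forall>i. a $ i \<in> {0, 1}}"

definition pmf_on_cube :: "(('d :: finite) rvec \<Rightarrow> real) \<Rightarrow> bool" where
  "pmf_on_cube q \<longleftrightarrow> (\<forall>a\<in>cube. 0 \<le> q a) \<and> (\<Sum>a\<in>cube. q a) = 1"

text \<open>
  A coordinate projection is given by its strictly increasing, nonempty list of indices; the
  dimension of its target space is the length of the list.
\<close>

definition coord_projs :: "('d :: linorder) list set" where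
  "coord_projs = {\<pi>. \<pi> \<noteq> [] \<and> sorted_wrt (<) \<pi>}"

definition id_proj :: "('d :: {finite, linorder}) list" where
  "id_proj = sorted_list_of_set UNIV"

definition proj_vec :: "('d :: finite) list \<Rightarrow> 'd rvec \<Rightarrow> nat \<Rightarrow> real" where
  "proj_vec \<pi> x = (\<lambda>k\<in>{..<length \<pi>}. x $ (\<pi> ! k))"

definition proj_mat :: "('d :: finite) list \<Rightarrow> 'd rmat \<Rightarrow> nat \<Rightarrow> nat \<Rightarrow> real" where
  "proj_mat \<pi> S = (\<lambda>k l. S $ (\<pi> ! k) $ (\<pi> ! l))"

definition proj_pmf :: "('d :: finite) list \<Rightarrow> ('d rvec \<Rightarrow> real) \<Rightarrow> (nat \<Rightarrow> real) \<Rightarrow> real" where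
  "proj_pmf \<pi> q a = (\<Sum>b | b \<in> cube \<and> proj_vec \<pi> b = a. q b)"

definition cube_dim :: "nat \<Rightarrow> (nat \<Rightarrow> real) set" where
  "cube_dim k = (\<Pi>\<^sub>E i\<in>{..<k}. {0, 1})"

definition inner_dim :: "nat \<Rightarrow> (nat \<Rightarrow> real) \<Rightarrow> (nat \<Rightarrow> real) \<Rightarrow> real" where
  "inner_dim k s t = (\<Sum>i<k. s i * t i)"

definition mult_mv :: "nat \<Rightarrow> (nat \<Rightarrow> nat \<Rightarrow> real) \<Rightarrow> (nat \<Rightarrow> real) \<Rightarrow> nat \<Rightarrow> real" where
  "mult_mv k A t = (\<lambda>i\<in>{..<k}. \<Sum>j<k. A i j * t j)"

definition diag_mat :: "(nat \<Rightarrow> real) \<Rightarrow> nat \<Rightarrow> nat \<Rightarrow> real" where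
  "diag_mat a = (\<lambda>i j. if i = j then a i else 0)"

definition std_normal :: "nat \<Rightarrow> (nat \<Rightarrow> real) measure" where
  "std_normal k = (\<Pi>\<^sub>M i\<in>{..<k}. density lborel (\<lambda>x. ennreal (std_normal_density x)))"

definition masked_cf ::
  "'a measure \<Rightarrow> ('a \<Rightarrow> ('d :: finite) rvec) \<Rightarrow> ('a \<Rightarrow> 'd rvec) \<Rightarrow> 'd rvec \<Rightarrow> 'd list \<Rightarrow> (nat \<Rightarrow> real) \<Rightarrow> complex"
where
  "masked_cf M I X m \<pi> t =
     (\<integral>\<omega>. exp (\<i> * complex_of_real (inner_dim (length \<pi>) t (proj_vec \<pi> (I \<omega> * (X \<omega> - m))))) \<partial>M)"

text \<open>
  With the true parameters this is $\phi_\pi$, with the estimated ones $\widehat\phi_{n,\pi}$.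
\<close>

definition normal_mixture_cf ::
  "('d :: finite) rmat \<Rightarrow> ('d rvec \<Rightarrow> real) \<Rightarrow> 'd list \<Rightarrow> (nat \<Rightarrow> real) \<Rightarrow> complex"
where
  "normal_mixture_cf S q \<pi> t = complex_of_real
     (\<Sum>a\<in>cube_dim (length \<pi>).
        exp (- (1 / 2) *
          inner_dim (length \<pi>)
            (mult_mv (length \<pi>) (diag_mat a)
              (mult_mv (length \<pi>) (proj_mat \<pi> S)
                (mult_mv (length \<pi>) (diag_mat a) t))) t)
        * proj_pmf \<pi> q a)"

definition empirical_masked_cf ::
  "nat \<Rightarrow> (nat \<Rightarrow> ('d :: finite) rvec) \<Rightarrow> (nat \<Rightarrow> 'd rvec) \<Rightarrow> 'd rvec \<Rightarrow> 'd list \<Rightarrow> (nat \<Rightarrow> real) \<Rightarrow> complex"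
where
  "empirical_masked_cf n b x m \<pi> t = 1 / of_nat n *
     (\<Sum>k = 1..n. exp (\<i> * complex_of_real (inner_dim (length \<pi>) t (proj_vec \<pi> (b k * (x k - m))))))"

text \<open>
  The test statistic as a function of the masks \<open>b k\<close>, the observations \<open>x k\<close> and the values
  \<open>m\<close>, \<open>S\<close>, \<open>q\<close> of the estimators.
\<close>

definition test_statistic_proj ::
  "nat \<Rightarrow> (nat \<Rightarrow> ('d :: finite) rvec) \<Rightarrow> (nat \<Rightarrow> 'd rvec) \<Rightarrow> 'd rvec \<Rightarrow> 'd rmat \<Rightarrow>
    ('d rvec \<Rightarrow> real) \<Rightarrow> 'd list \<Rightarrow> real"
where
  "test_statistic_proj n b x m S q \<pi> = real n *
     (\<integral>t. (cmod (empirical_masked_cf n b x m \<pi> t - normal_mixture_cf S q \<pi> t))\<^sup>2 \<partial>std_normal (length \<pi>))"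

definition test_statistic ::
  "(('d :: {finite, linorder}) list \<Rightarrow> real) \<Rightarrow> nat \<Rightarrow> (nat \<Rightarrow> 'd rvec) \<Rightarrow> (nat \<Rightarrow> 'd rvec) \<Rightarrow>
    'd rvec \<Rightarrow> 'd rmat \<Rightarrow> ('d rvec \<Rightarrow> real) \<Rightarrow> real"
where
  "test_statistic w n b x m S q = (\<Sum>\<pi>\<in>coord_projs. w \<pi> * test_statistic_proj n b x m S q \<pi>)"

text \<open>
  A sample of size \<open>n\<close> consists of the observable pairs (mask, masked vector), with masks
  in $\{0,1\}^d$.
\<close>

definition obs_space :: "(('d :: finite) rvec \<times> 'd rvec) measure" where
  "obs_space = restrict_space borel (cube \<times> UNIV)"

definition sample_space :: "nat \<Rightarrow> (nat \<Rightarrow> ('d :: finite) rvec \<times> 'd rvec) measure" where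
  "sample_space n = (\<Pi>\<^sub>M k\<in>{1..n}. obs_space)"

definition sample ::
  "nat \<Rightarrow> (nat \<Rightarrow> 'a \<Rightarrow> ('d :: finite) rvec) \<Rightarrow> (nat \<Rightarrow> 'a \<Rightarrow> 'd rvec) \<Rightarrow> 'a \<Rightarrow> nat \<Rightarrow> 'd rvec \<times> 'd rvec"
where
  "sample n Is Xs \<omega> = (\<lambda>k\<in>{1..n}. (Is k \<omega>, Is k \<omega> * Xs k \<omega>))"

end

theory Submission
  imports Defs
begin

text \<open>
  \<^emph>\<open>Reduction to functions on $\mathbb R^d$.\<close>  For $t \in \mathbb R^{d_\pi}$ let $u = \pi^* t$, where $\pi^*$ is the
  adjoint of the projection $\pi$.  Then $\varphi_\pi(t)$, $\phi_\pi(t)$ and their empirical versions depend on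
  $\pi$ and $t$ through $u$ only.  With $D(u) = \mathrm E \exp(i \langle u, X - \mu\rangle) - \exp(-\frac12 \langle \Sigma u, u\rangle)$,
  the independence of mask and vector gives $\varphi_\pi(t) - \phi_\pi(t) = G(u)$ with
  $G(u) = \sum_b p(b) D(b \odot u)$, a bounded continuous function of $u$.

  \<^emph>\<open>Convergence.\<close>  For fixed $u$ the empirical characteristic function centred at $\mu$ is an average of
  bounded iid variables, so it converges almost surely (\<open>strong_law_bounded_iid_complex\<close>, by Hoeffding's
  inequality and Borel-Cantelli).  By Fubini, almost surely it converges for almost every $t$
  (\<open>AE_pointwise_limit_commute\<close>).  Replacing $\mu$ by $\widehat\mu_n$ changes it by at most
  $|u| |\widehat\mu_n - \mu|$, the mixture $\widehat\phi_{n,\pi}$ converges pointwise, and all functions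
  are bounded by 1; dominated convergence gives the limit (\<open>test_statistic_proj_tendsto\<close>).

  \<^emph>\<open>The limit vanishes exactly under normality.\<close>  If $X$ is normal then its parameters are $\mu$ and $\Sigma$
  (\<open>normal_law_parameters\<close>), hence $D = 0$ and $\kappa = 0$.  Conversely, if $\kappa = 0$ then the term of
  the identity projection, which has positive weight, vanishes; so $G = 0$ almost everywhere and, by continuity,
  everywhere.  Because $p(\mathbf 1) > 0$, the mixture over the masks can be inverted and $D = 0$
  (\<open>cube_mixture_injective\<close>).  Thus $X$ has the characteristic function of the normal law with parameters
  $\mu$ and $\Sigma$, and it has that law by uniqueness (\<open>cf_uniqueness\<close>).

  The facts about normal laws come from a factorization $S = B B^\top$ (\<open>pos_def_factorization\<close>), which makes
  the normal law with parameters $m$ and $S$ the image of the standard Gaussian under $z \mapsto m + B z$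
  (\<open>normal_law_affine_image\<close>).
\<close>

section \<open>Almost sure limits of empirical averages\<close>

text \<open>
  Hoeffding's inequality bounds the probability that the average of the first $n$ variables deviates by
  $1/(m+1)$ by a geometric sequence in $n$, so Borel-Cantelli excludes infinitely many deviations; countably
  many $m$ suffice.
\<close>

lemma (in prob_space) strong_law_bounded_iid:
  fixes Y :: "nat \<Rightarrow> 'a \<Rightarrow> real"
  assumes indep: "indep_vars (\<lambda>_. borel) Y {1..}"
    and distr: "\<And>k. k \<ge> 1 \<Longrightarrow> distr M borel (Y k) = distr M borel Z"
    and [measurable]: "Z \<in> borel_measurable M"
    and bounded: "\<And>\<omega>. \<omega> \<in> space M \<Longrightarrow> \<bar>Z \<omega>\<bar> \<le> 1"
  shows "AE \<omega> in M. (\<lambda>n. (\<Sum>k=1..n. Y k \<omega>) / real n) \<longlonglongrightarrow> expectation Z"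
proof -
  have Y [measurable]: "Y k \<in> borel_measurable M" if "k \<ge> 1" for k
    using indep that unfolding indep_vars_def by auto
  have Y_sum [measurable]: "(\<lambda>\<omega>. (\<Sum>k=1..n. Y k \<omega>) / real n) \<in> borel_measurable M" for n
    by (intro borel_measurable_divide borel_measurable_sum Y) auto
  define bad where "bad m n = {\<omega>\<in>space M. \<bar>(\<Sum>k=1..n. Y k \<omega>) / real n - expectation Z\<bar> \<ge> 1 / real (Suc m)}" for m n
  have bad_sets: "bad m n \<in> sets M" for m n
    unfolding bad_def using Y_sum[of n] by measurable
  have tail: "prob (bad m n) \<le> 2 * exp (- (1 / 2) * (1 / real (Suc m))\<^sup>2) ^ n" if n: "n \<ge> 1" for m n
  proof -
    interpret Hoeffding_ineq_iid M "{1..n}" Y Z "-1" 1 "expectation Z"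
    proof unfold_locales
      show "indep_vars (\<lambda>_. borel) Y {1..n}"
        by (rule indep_vars_subset[OF indep]) auto
      show "AE x in M. Z x \<in> {-1..1}"
        using bounded by (intro AE_I2) (auto simp: abs_le_iff minus_le_iff)
    qed (use distr in auto)
    have "prob (bad m n) \<le> 2 * exp (-2 * real n * (1 / real (Suc m))\<^sup>2 / (1 - (-1))\<^sup>2)"
      using Hoeffding_ineq_abs_ge'[of "1 / real (Suc m)"] n by (simp add: bad_def)
    also have "\<dots> = 2 * exp (- (1 / 2) * (1 / real (Suc m))\<^sup>2) ^ n"
      by (simp add: exp_of_nat_mult[symmetric] field_simps)
    finally show ?thesis .
  qed
  have "AE \<omega> in M. \<forall>\<^sub>F n in sequentially. \<omega> \<in> space M - bad m n" for m
  proof (rule borel_cantelli_AE1)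
    have "summable (\<lambda>n. 2 * exp (- (1 / 2) * (1 / real (Suc m))\<^sup>2) ^ n)"
      by (intro summable_mult summable_geometric) simp
    then show "summable (\<lambda>n. prob (bad m n))"
      by (rule summable_comparison_test'[of _ 1]) (use tail in \<open>simp add: measure_nonneg\<close>)
  qed (use bad_sets in \<open>auto simp: less_top[symmetric]\<close>)
  then have "AE \<omega> in M. \<forall>m. \<forall>\<^sub>F n in sequentially. \<omega> \<in> space M - bad m n"
    by (simp add: AE_all_countable)
  then show ?thesis
  proof (rule AE_mp, intro AE_I2 impI)
    fix \<omega> assume \<omega>: "\<omega> \<in> space M" and *: "\<forall>m. \<forall>\<^sub>F n in sequentially. \<omega> \<in> space M - bad m n"
    show "(\<lambda>n. (\<Sum>k=1..n. Y k \<omega>) / real n) \<longlonglongrightarrow> expectation Z"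
    proof (rule tendstoI)
      fix e :: real assume "e > 0"
      then obtain m where m: "1 / real (Suc m) < e" using nat_approx_posE by blast
      show "\<forall>\<^sub>F n in sequentially. dist ((\<Sum>k=1..n. Y k \<omega>) / real n) (expectation Z) < e"
        using *[rule_format, of m]
        by eventually_elim (use m \<omega> in \<open>auto simp: bad_def dist_real_def\<close>)
    qed
  qed
qed

lemma (in prob_space) strong_law_bounded_iid_complex:
  fixes f :: "'b::second_countable_topology \<Rightarrow> complex"
  assumes indep: "indep_vars (\<lambda>_. borel) Y {1..}"
    and distr: "\<And>k. k \<ge> 1 \<Longrightarrow> distr M borel (Y k) = distr M borel Z"
    and Z[measurable]: "Z \<in> borel_measurable M"
    and f[measurable]: "f \<in> borel_measurable borel" and bounded: "\<And>y. cmod (f y) \<le> 1"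
  shows "AE \<omega> in M. (\<lambda>n. 1 / of_nat n * (\<Sum>k=1..n. f (Y k \<omega>))) \<longlonglongrightarrow> (\<integral>\<omega>. f (Z \<omega>) \<partial>M)"
proof -
  have Y [measurable]: "Y k \<in> borel_measurable M" if "k \<ge> 1" for k
    using indep that unfolding indep_vars_def by auto
  have law: "AE \<omega> in M. (\<lambda>n. (\<Sum>k=1..n. g (Y k \<omega>)) / real n) \<longlonglongrightarrow> (\<integral>\<omega>. g (Z \<omega>) \<partial>M)"
    if [measurable]: "g \<in> borel_measurable borel" and g: "\<And>y. \<bar>g y\<bar> \<le> 1" for g :: "'b \<Rightarrow> real"
  proof (rule strong_law_bounded_iid)
    show "indep_vars (\<lambda>_. borel) (\<lambda>k \<omega>. g (Y k \<omega>)) {1..}"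
      by (rule indep_vars_compose2[OF indep]) auto
    fix k :: nat assume k: "k \<ge> 1"
    have "distr M borel (\<lambda>\<omega>. g (Y k \<omega>)) = distr (distr M borel (Y k)) borel g"
      using Y[OF k] by (subst distr_distr) (auto simp: comp_def)
    also have "\<dots> = distr M borel (\<lambda>\<omega>. g (Z \<omega>))"
      unfolding distr[OF k] by (subst distr_distr) (auto simp: comp_def)
    finally show "distr M borel (\<lambda>\<omega>. g (Y k \<omega>)) = distr M borel (\<lambda>\<omega>. g (Z \<omega>))" .
  qed (use g in auto)
  have int: "integrable M (\<lambda>\<omega>. f (Z \<omega>))"
    using bounded by (intro integrable_const_bound[of _ 1]) auto
  have "AE \<omega> in M. (\<lambda>n. (\<Sum>k=1..n. Re (f (Y k \<omega>))) / real n) \<longlonglongrightarrow> (\<integral>\<omega>. Re (f (Z \<omega>)) \<partial>M)"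
    by (rule law) (auto intro: order_trans[OF abs_Re_le_cmod bounded])
  moreover have "AE \<omega> in M. (\<lambda>n. (\<Sum>k=1..n. Im (f (Y k \<omega>))) / real n) \<longlonglongrightarrow> (\<integral>\<omega>. Im (f (Z \<omega>)) \<partial>M)"
    by (rule law) (auto intro: order_trans[OF abs_Im_le_cmod bounded])
  ultimately show ?thesis
  proof eventually_elim
    case (elim \<omega>)
    then show ?case
      using int by (auto simp: tendsto_complex_iff Re_divide_of_nat Im_divide_of_nat)
  qed
qed

text \<open>
  For each \<open>y\<close> the exceptional null set of \<open>x\<close> may depend on \<open>y\<close>.  The set of pairs at which convergence
  fails is measurable, because convergence is a countable combination of conditions on measurable functions;
  by Fubini one null set of \<open>x\<close> then works for almost every \<open>y\<close>.
\<close>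

lemma AE_pointwise_limit_commute:
  fixes f :: "nat \<Rightarrow> 'a \<Rightarrow> 'b \<Rightarrow> 'c::{second_countable_topology, metric_space}"
  assumes "sigma_finite_measure M" "sigma_finite_measure N"
    and f[measurable]: "\<And>n. (\<lambda>(x, y). f n x y) \<in> borel_measurable (M \<Otimes>\<^sub>M N)"
    and L[measurable]: "L \<in> borel_measurable N"
    and lim: "\<And>y. y \<in> space N \<Longrightarrow> AE x in M. (\<lambda>n. f n x y) \<longlonglongrightarrow> L y"
  shows "AE x in M. AE y in N. (\<lambda>n. f n x y) \<longlonglongrightarrow> L y"
proof -
  interpret M: sigma_finite_measure M by fact
  interpret N: sigma_finite_measure N by fact
  interpret pair_sigma_finite M N ..
  have iff: "(\<lambda>n. f n x y) \<longlonglongrightarrow> L y \<longleftrightarrow> (\<forall>m::nat. \<exists>n0. \<forall>n\<ge>n0. dist (f n x y) (L y) < 1 / real (Suc m))" for x y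
  proof
    assume "(\<lambda>n. f n x y) \<longlonglongrightarrow> L y"
    then show "\<forall>m::nat. \<exists>n0. \<forall>n\<ge>n0. dist (f n x y) (L y) < 1 / real (Suc m)"
      by (auto simp: lim_sequentially)
  next
    assume "\<forall>m::nat. \<exists>n0. \<forall>n\<ge>n0. dist (f n x y) (L y) < 1 / real (Suc m)"
    then show "(\<lambda>n. f n x y) \<longlonglongrightarrow> L y"
      unfolding lim_sequentially by (meson less_trans nat_approx_posE)
  qed
  have "(AE x in M. AE y in N. (\<lambda>n. f n x y) \<longlonglongrightarrow> L y) \<longleftrightarrow> (AE y in N. AE x in M. (\<lambda>n. f n x y) \<longlonglongrightarrow> L y)"
  proof (rule AE_commute)
    have [measurable]: "(\<lambda>z. f n (fst z) (snd z)) \<in> borel_measurable (M \<Otimes>\<^sub>M N)" for n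
      using f[of n] by (simp add: case_prod_unfold)
    show "{z \<in> space (M \<Otimes>\<^sub>M N). (\<lambda>n. f n (fst z) (snd z)) \<longlonglongrightarrow> L (snd z)} \<in> sets (M \<Otimes>\<^sub>M N)"
      unfolding iff by measurable
  qed
  then show ?thesis using lim by auto
qed

section \<open>Linear changes of variables for Lebesgue measure\<close>

text \<open>
  Both sides are multiplicative in the matrix, so it suffices to treat elementary matrices: those with a zero row have
  negligible image, diagonal ones stretch the axes, and for transpositions and shears, of determinant $\pm 1$,
  boxes keep their volume.
\<close>

lemma measure_matrix_image:
  fixes A :: "real^'n^'n"
  shows "\<forall>S\<in>lmeasurable. ((*v) A) ` S \<in> lmeasurable \<and>
    measure lebesgue (((*v) A) ` S) = \<bar>det A\<bar> * measure lebesgue S"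
proof (induction A rule: induct_matrix_elementary_alt)
  case (1 A B)
  note mult = this
  have "(*v) (A ** B) ` S = (*v) A ` ((*v) B ` S)" for S :: "(real^'n) set"
    by (simp add: image_image matrix_vector_mul_assoc)
  then show ?case
    using mult by (simp only: det_mul abs_mult) simp
next
  case (2 A i)
  note zero_row = this
  then have det: "det A = 0" by (simp add: det_zero_row)
  then have "\<not> inj ((*v) A)"
    using det_nz_iff_inj[of "(*v) A"] by (simp add: matrix_of_matrix_vector_mul)
  then have "negligible (((*v) A) ` S)" for S
    by (intro negligible_linear_singular_image) (auto simp: matrix_vector_mul_linear)
  then show ?case
    using det by (auto simp: negligible_iff_measure)
next
  case (3 A)
  note diagonal = this
  have eq: "(*v) A = (\<lambda>x. \<chi> i. A $ i $ i * x $ i)"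
  proof (intro ext, simp add: vec_eq_iff matrix_vector_mult_def, intro allI)
    fix x :: "real^'n" and i
    have "(\<Sum>j\<in>UNIV. A $ i $ j * x $ j) = (\<Sum>j\<in>UNIV. if j = i then A $ i $ i * x $ i else 0)"
      using diagonal[of i] by (intro sum.cong) auto
    then show "(\<Sum>j\<in>UNIV. A $ i $ j * x $ j) = A $ i $ i * x $ i" by simp
  qed
  show ?case
    using diagonal by (simp add: eq measurable_stretch measure_stretch det_diagonal)
next
  case (4 m n)
  note swap1 = this
  let ?A = "(\<chi> i j. mat 1 $ i $ Transposition.transpose m n j) :: real^'n^'n"
  let ?h = "\<lambda>v::real^'n. \<chi> i. v $ Transposition.transpose m n i"
  have app: "(*v) ?A = ?h"
  proof (intro ext, simp add: vec_eq_iff matrix_vector_mult_def, intro allI)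
    fix x :: "real^'n" and i
    have "(\<Sum>j\<in>UNIV. mat 1 $ i $ Transposition.transpose m n j * x $ j)
        = (\<Sum>j\<in>UNIV. if j = Transposition.transpose m n i then x $ j else 0)"
      by (intro sum.cong refl) (auto simp: mat_def Transposition.transpose_def)
    then show "(\<Sum>j\<in>UNIV. mat 1 $ i $ Transposition.transpose m n j * x $ j) = x $ Transposition.transpose m n i" by simp
  qed
  have det: "\<bar>det ?A\<bar> = 1"
    using swap1 by (simp add: det_permute_columns permutes_swap_id sign_swap_id abs_mult)
  have lin: "linear ?h"
    using matrix_vector_mul_linear[of ?A] by (simp only: app)
  have "measure lebesgue (?h ` cbox a b) = measure lebesgue (cbox a b)" for a b
  proof (cases "cbox a b = {}")
    case False
    have involution: "?h (?h v) = v" for v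
      by (simp add: vec_eq_iff)
    have mem: "?h v \<in> cbox a b \<longleftrightarrow> v \<in> cbox (?h a) (?h b)" for v
      unfolding mem_box_cart vec_lambda_beta by (metis transpose_involutory)
    have img: "?h ` cbox a b = cbox (?h a) (?h b)"
    proof (intro equalityI subsetI)
      fix v assume "v \<in> ?h ` cbox a b"
      then obtain y where "y \<in> cbox a b" "v = ?h y" by blast
      then show "v \<in> cbox (?h a) (?h b)" using mem[of v] involution[of y] by simp
    next
      fix v assume "v \<in> cbox (?h a) (?h b)"
      then show "v \<in> ?h ` cbox a b"
        using mem[of v] involution[of v] by (metis imageI)
    qed
    moreover have "cbox (?h a) (?h b) \<noteq> {}"
      using False img by blast
    ultimately show ?thesis
      using False prod.permute[OF permutes_swap_id, where S=UNIV and g="\<lambda>i. (b - a) $ i", of m n]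
      by (simp add: content_cbox_cart)
  qed simp
  then have "?h ` S \<in> lmeasurable \<and> measure lebesgue (?h ` S) = measure lebesgue S"
    if "S \<in> lmeasurable" for S
    using measure_linear_sufficient[OF lin that, of 1] by simp
  then show ?case
    unfolding app det by simp
next
  case (5 m n)
  note idplus = this
  let ?A = "(\<chi> i j. of_bool (i = m \<and> j = n \<or> i = j)) :: real^'n^'n"
  let ?h = "\<lambda>v::real^'n. \<chi> i. if i = m then v $ m + v $ n else v $ i"
  have app: "(*v) ?A = ?h"
  proof (rule ext)
    fix x :: "real^'n"
    have "(?A *v x) $ i = ?h x $ i" for i
    proof -
      have "(?A *v x) $ i = (\<Sum>j\<in>UNIV. (if j = i then x $ j else 0) + (if i = m \<and> j = n then x $ j else 0))"
        unfolding matrix_vector_mult_def vec_lambda_beta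
        using idplus by (intro sum.cong refl) (simp add: of_bool_def)
      also have "\<dots> = ?h x $ i"
        by (cases "i = m") (simp_all add: sum.distrib)
      finally show ?thesis .
    qed
    then show "?A *v x = ?h x"
      unfolding vec_eq_iff by blast
  qed
  have "?A = (\<chi> k. if k = m then row m (mat 1) + 1 *s row n (mat 1) else row k (mat 1))"
    using idplus by (auto simp: vec_eq_iff row_def mat_def)
  then have det: "det ?A = 1"
    using det_row_operation[OF idplus, of "mat 1 :: real^'n^'n" 1] by simp
  have lin: "linear ?h"
    using matrix_vector_mul_linear[of ?A] by (simp only: app)
  have "measure lebesgue (?h ` cbox a b) = measure lebesgue (cbox a b)" for a b
  proof (cases "cbox a b = {}")
    case False
    \<comment> \<open>The volume formula for sheared boxes asks for a nonnegative lower end in direction \<open>n\<close>; as the shear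
        is linear, the box may be translated there.\<close>
    define c where "c = (\<chi> i. if i = n then - a $ n else 0)"
    have box: "cbox (c + a) (c + b) = (+) c ` cbox a b"
      by (simp add: cbox_translation)
    have ne: "cbox (c + a) (c + b) \<noteq> {}"
      using False by (simp add: box)
    have "measure lebesgue (?h ` cbox a b) = measure lebesgue ((+) (?h c) ` (?h ` cbox a b))"
      by (rule measure_translation[symmetric])
    also have "(+) (?h c) ` (?h ` cbox a b) = ?h ` cbox (c + a) (c + b)"
      unfolding box image_image by (simp add: linear_add[OF lin] del: vec_lambda_beta)
    also have "measure lebesgue \<dots> = measure lebesgue (cbox (c + a) (c + b))"
      using idplus ne by (intro measure_shear_interval) (simp_all add: c_def)
    also have "\<dots> = measure lebesgue (cbox a b)"
      unfolding box by (rule measure_translation)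
    finally show ?thesis .
  qed simp
  then have "?h ` S \<in> lmeasurable \<and> measure lebesgue (?h ` S) = measure lebesgue S"
    if "S \<in> lmeasurable" for S
    using measure_linear_sufficient[OF lin that, of 1] by simp
  then show ?case
    unfolding app det abs_one by simp
qed

text \<open>
  The matrix scales the volume of boxes by its determinant, and boxes determine Lebesgue measure; translations
  preserve it.
\<close>

lemma nn_integral_lborel_affine_invertible:
  fixes A :: "real^'n^'n" and f :: "real^'n \<Rightarrow> ennreal"
  assumes "invertible A" and [measurable]: "f \<in> borel_measurable borel"
  shows "(\<integral>\<^sup>+x. f x \<partial>lborel) = ennreal \<bar>det A\<bar> * (\<integral>\<^sup>+x. f (m + A *v x) \<partial>lborel)"
proof -
  obtain A' where A': "A ** A' = mat 1" "A' ** A = mat 1"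
    using assms(1) by (auto simp: invertible_def)
  have [measurable]: "(\<lambda>x. m + A *v x) \<in> borel_measurable borel" "(*v) A \<in> borel_measurable borel"
    by (intro borel_measurable_continuous_onI continuous_intros matrix_vector_mult_linear_continuous_on)+
  have det: "\<bar>det A\<bar> * \<bar>det A'\<bar> = 1"
    using det_mul[of A A'] by (simp add: A' abs_mult[symmetric])
  have "lborel = density (distr lborel borel ((*v) A)) (\<lambda>_. ennreal \<bar>det A\<bar>)"
  proof (rule lborel_eqI)
    fix l u :: "real^'n" assume le: "\<And>b. b \<in> Basis \<Longrightarrow> l \<bullet> b \<le> u \<bullet> b"
    have pre: "(*v) A -` box l u = (*v) A' ` box l u"
      using A' by (auto simp: image_iff matrix_vector_mul_assoc) (metis matrix_vector_mul_assoc matrix_vector_mul_lid)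
    have "(*v) A -` box l u \<in> sets borel"
      using measurable_sets_borel[of "(*v) A" borel "box l u"] by simp
    then have pre_sets: "(*v) A' ` box l u \<in> sets borel" by (simp add: pre)
    have "emeasure (density (distr lborel borel ((*v) A)) (\<lambda>_. ennreal \<bar>det A\<bar>)) (box l u)
        = ennreal \<bar>det A\<bar> * emeasure lborel ((*v) A' ` box l u)"
      by (simp add: emeasure_density nn_integral_cmult_indicator emeasure_distr pre)
    also have "emeasure lborel ((*v) A' ` box l u) = emeasure lebesgue ((*v) A' ` box l u)"
      using pre_sets by simp
    also have "\<dots> = ennreal (measure lebesgue ((*v) A' ` box l u))"
      using measure_matrix_image[of A'] by (intro emeasure_eq_measure2) simp
    also have "measure lebesgue ((*v) A' ` box l u) = \<bar>det A'\<bar> * (\<Prod>b\<in>Basis. (u - l) \<bullet> b)"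
      using measure_matrix_image[of A'] le by (simp add: measure_lborel_box_eq)
    also have "ennreal \<bar>det A\<bar> * ennreal (\<bar>det A'\<bar> * (\<Prod>b\<in>Basis. (u - l) \<bullet> b)) = ennreal (\<Prod>b\<in>Basis. (u - l) \<bullet> b)"
      using det by (simp add: ennreal_mult'[symmetric] mult.assoc[symmetric])
    finally show "emeasure (density (distr lborel borel ((*v) A)) (\<lambda>_. ennreal \<bar>det A\<bar>)) (box l u)
        = (\<Prod>b\<in>Basis. (u - l) \<bullet> b)" .
  qed simp
  note scaling = this
  have "(\<integral>\<^sup>+x. f x \<partial>lborel) = (\<integral>\<^sup>+x. f x \<partial>distr lborel borel ((+) m))"
    by (simp add: lborel_distr_plus)
  also have "\<dots> = (\<integral>\<^sup>+x. f (m + x) \<partial>lborel)"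
    by (simp add: nn_integral_distr)
  also have "\<dots> = (\<integral>\<^sup>+x. f (m + x) \<partial>density (distr lborel borel ((*v) A)) (\<lambda>_. ennreal \<bar>det A\<bar>))"
    by (subst scaling) simp
  also have "\<dots> = ennreal \<bar>det A\<bar> * (\<integral>\<^sup>+x. f (m + A *v x) \<partial>lborel)"
    by (simp add: nn_integral_density nn_integral_distr nn_integral_cmult)
  finally show ?thesis .
qed

section \<open>Factorization of positive definite matrices, and measures on orthants\<close>

lemma measurable_component_vec [measurable]: "(\<lambda>x. x $ i) \<in> borel_measurable (borel :: (real^'n) measure)"
  by (intro borel_measurable_continuous_onI continuous_intros)

lemma inner_matrix_symmetric:
  fixes S :: "real^'n^'n"
  assumes "transpose S = S"
  shows "(S *v x) \<bullet> y = (S *v y) \<bullet> x"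
  using assms by (metis dot_lmul_matrix inner_commute transpose_matrix_vector)

text \<open>
  This is the Gram-Schmidt process for the scalar product $\langle S x, y\rangle$, applied to the unit vectors
  with indices in \<open>J\<close>.  The support condition is what keeps it going: for $k \notin J$ the vectors found so far
  have $k$-th coordinate 0, so the residue of the $k$-th unit vector has $k$-th coordinate 1 and can be
  normalized.
\<close>

lemma pos_def_orthonormal_vectors:
  fixes S :: "('n::finite) rmat"
  assumes S: "pos_def S"
  shows "\<exists>v :: 'n \<Rightarrow> 'n rvec. (\<forall>i\<in>J. \<forall>j\<in>J. (S *v v i) \<bullet> v j = of_bool (i = j)) \<and>
    (\<forall>i\<in>J. \<forall>k. k \<notin> J \<longrightarrow> v i $ k = 0)"
proof (induction J rule: finite_induct[OF finite])
  case 1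
  then show ?case by simp
next
  case (2 k J)
  then obtain v :: "'n \<Rightarrow> 'n rvec" where orth: "\<And>i j. i \<in> J \<Longrightarrow> j \<in> J \<Longrightarrow> (S *v v i) \<bullet> v j = of_bool (i = j)"
    and supp: "\<And>i l. i \<in> J \<Longrightarrow> l \<notin> J \<Longrightarrow> v i $ l = 0" by blast
  have sym: "(S *v x) \<bullet> y = (S *v y) \<bullet> x" for x y
    using S by (intro inner_matrix_symmetric) (simp add: pos_def_def)
  define u where "u = axis k 1 - (\<Sum>i\<in>J. ((S *v axis k 1) \<bullet> v i) *\<^sub>R v i)"
  have u_orth: "(S *v v j) \<bullet> u = 0" if "j \<in> J" for j
  proof -
    have "(S *v v j) \<bullet> u = (S *v v j) \<bullet> axis k 1 - (\<Sum>i\<in>J. ((S *v axis k 1) \<bullet> v i) * of_bool (j = i))"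
      using that orth by (simp add: u_def inner_diff_right inner_sum_right)
    also have "\<dots> = 0"
      using that 2 by (simp add: of_bool_def sym[of "v j"] if_distrib cong: if_cong)
    finally show ?thesis .
  qed
  have "u $ k = 1"
    using supp 2 by (simp add: u_def sum_component)
  then have "u \<noteq> 0" by auto
  then have pos: "0 < (S *v u) \<bullet> u"
    using S by (simp add: pos_def_def)
  define w where "w = v(k := (1 / sqrt ((S *v u) \<bullet> u)) *\<^sub>R u)"
  have "(S *v w k) \<bullet> w k = (S *v u) \<bullet> u / (sqrt ((S *v u) \<bullet> u) * sqrt ((S *v u) \<bullet> u))"
    by (simp add: w_def matrix_vector_mult_scaleR)
  then have "(S *v w k) \<bullet> w k = 1"
    using pos by simp
  moreover have "(S *v w j) \<bullet> w k = 0" "(S *v w k) \<bullet> w j = 0" if "j \<in> J" for j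
    using that 2 u_orth[OF that] sym[of u "v j"]
    by (auto simp: w_def matrix_vector_mult_scaleR)
  moreover have "(S *v w i) \<bullet> w j = of_bool (i = j)" if "i \<in> J" "j \<in> J" for i j
    using that 2 orth[OF that] by (auto simp: w_def)
  ultimately have "\<forall>i\<in>insert k J. \<forall>j\<in>insert k J. (S *v w i) \<bullet> w j = of_bool (i = j)"
    using 2 by auto
  moreover have "\<forall>i\<in>insert k J. \<forall>l. l \<notin> insert k J \<longrightarrow> w i $ l = 0"
    using supp by (auto simp: w_def u_def sum_component axis_def)
  ultimately show ?case by blast
qed

text \<open>
  A matrix $V$ whose columns are orthonormal for $\langle S x, y\rangle$ satisfies $V^\top S V = 1$, so
  $B = (V^{-1})^\top$ is a factor.
\<close>

lemma pos_def_factorization: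
  fixes S :: "('n::finite) rmat"
  assumes S: "pos_def S"
  obtains B :: "'n rmat" where "invertible B" "S = B ** transpose B"
proof -
  obtain v :: "'n \<Rightarrow> 'n rvec" where v: "\<And>i j. (S *v v i) \<bullet> v j = of_bool (i = j)"
    using pos_def_orthonormal_vectors[OF S, of UNIV] by auto
  define V where "V = (\<chi> i j. v j $ i)"
  have eq: "transpose V ** (S ** V) = mat 1"
  proof -
    have "(transpose V ** (S ** V)) $ i $ j = mat 1 $ i $ j" for i j
    proof -
      have "(transpose V ** (S ** V)) $ i $ j = (S *v v j) \<bullet> v i"
        by (simp add: V_def matrix_matrix_mult_def matrix_vector_mult_def transpose_def inner_vec_def mult.commute)
      then show ?thesis
        by (auto simp: v mat_def)
    qed
    then show ?thesis unfolding vec_eq_iff by blast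
  qed
  then have "invertible V"
    unfolding invertible_left_inverse by (metis matrix_mul_assoc)
  then obtain V' where V': "V ** V' = mat 1" "V' ** V = mat 1"
    by (auto simp: invertible_def)
  show ?thesis
  proof (rule that[of "transpose V'"])
    show "invertible (transpose V')"
      using V' by (metis invertible_def matrix_transpose_mul transpose_mat)
    have "S = transpose (V ** V') ** S ** (V ** V')"
      by (simp add: V' transpose_mat)
    also have "\<dots> = transpose V' ** (transpose V ** (S ** V)) ** V'"
      by (simp add: matrix_transpose_mul matrix_mul_assoc)
    also have "\<dots> = transpose V' ** transpose (transpose V')"
      by (simp add: eq)
    finally show "S = transpose V' ** transpose (transpose V')" .
  qed
qed

text \<open>
  The orthants generate the Borel sets and are stable under intersection, so they determine a finite measure.
\<close>

lemma measure_eqI_orthants: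
  fixes P Q :: "(real^'n) measure"
  assumes sets: "sets P = sets borel" "sets Q = sets borel" and "finite_measure P"
    and eq: "\<And>a. emeasure P {..a} = emeasure Q {..a}"
  shows "P = Q"
proof -
  interpret finite_measure P by fact
  have gen: "sets borel = sigma_sets UNIV (range (\<lambda>a::real^'n. {..a}))"
    using arg_cong[OF borel_eq_atMost, of sets] by simp
  show ?thesis
  proof (rule measure_eqI_generator_eq[where E="range (\<lambda>a::real^'n. {..a})" and \<Omega>=UNIV and A="\<lambda>n. {.. \<chi> i. real n}"])
    show "Int_stable (range (\<lambda>a::real^'n. {..a}))"
    proof (rule Int_stableI, safe)
      fix a b :: "real^'n"
      have "{..a} \<inter> {..b} = {..inf a b}" by auto
      then show "{..a} \<inter> {..b} \<in> range atMost" by blast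
    qed
    have "\<exists>n::nat. \<forall>i. x $ i \<le> real n" for x :: "real^'n"
    proof -
      obtain n :: nat where n: "Max (range (($) x)) \<le> real n" using real_arch_simple by blast
      have "x $ i \<le> Max (range (($) x))" for i by (rule Max_ge) auto
      then show ?thesis using n by (meson order_trans)
    qed
    then show "(\<Union>n. {.. \<chi> i. real n}) = (UNIV :: (real^'n) set)"
      by (auto simp: less_eq_vec_def)
    show "sets P = sigma_sets UNIV (range (\<lambda>a::real^'n. {..a}))" "sets Q = sigma_sets UNIV (range (\<lambda>a::real^'n. {..a}))"
      using sets gen by simp_all
    show "emeasure P X = emeasure Q X" if "X \<in> range (\<lambda>a::real^'n. {..a})" for X
      using that eq by blast
  qed (auto simp: emeasure_eq_measure)
qed

lemma nn_integral_lborel_prod_vec: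
  fixes g :: "'n::finite \<Rightarrow> real \<Rightarrow> ennreal"
  assumes [measurable]: "\<And>i. g i \<in> borel_measurable borel"
  shows "(\<integral>\<^sup>+x. (\<Prod>i\<in>UNIV. g i (x $ i)) \<partial>(lborel :: (real^'n) measure)) = (\<Prod>i\<in>UNIV. \<integral>\<^sup>+y. g i y \<partial>lborel)"
proof -
  define e :: "'n \<Rightarrow> real^'n" where "e i = axis i 1" for i
  have inj: "inj e" by (auto simp: e_def inj_on_def axis_eq_axis)
  have bij: "bij_betw e UNIV Basis"
    using inj by (auto simp: bij_betw_def Basis_vec_def e_def)
  have "(\<integral>\<^sup>+x. (\<Prod>b\<in>Basis. g (inv e b) (x \<bullet> b)) \<partial>(lborel :: (real^'n) measure))
      = (\<Prod>b\<in>Basis. \<integral>\<^sup>+y. g (inv e b) y \<partial>lborel)"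
    by (rule nn_integral_lborel_prod) auto
  then show ?thesis
    unfolding prod.reindex_bij_betw[OF bij, symmetric] inv_f_f[OF inj]
    by (simp add: e_def inner_axis)
qed

section \<open>Coordinate projections and the standard Gaussian measure\<close>

text \<open>
  The adjoint of the coordinate projection.  It carries arguments of characteristic functions on the spaces of
  dimension \<open>length \<pi>\<close>, which vary with \<open>\<pi>\<close>, to the one space \<open>real ^ 'd\<close>.
\<close>

definition proj_adjoint :: "('d::finite) list \<Rightarrow> (nat \<Rightarrow> real) \<Rightarrow> 'd rvec" where
  "proj_adjoint \<pi> t = (\<chi> i. \<Sum>k<length \<pi>. if \<pi> ! k = i then t k else 0)"

lemma inner_dim_proj_vec: "inner_dim (length \<pi>) t (proj_vec \<pi> x) = proj_adjoint \<pi> t \<bullet> x"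
proof -
  have "proj_adjoint \<pi> t \<bullet> x = (\<Sum>i\<in>UNIV. \<Sum>k<length \<pi>. if \<pi> ! k = i then t k * x $ i else 0)"
    by (simp add: proj_adjoint_def inner_vec_def sum_distrib_right if_distrib[of "\<lambda>y. y * _"] cong: if_cong)
  also have "\<dots> = (\<Sum>k<length \<pi>. t k * x $ (\<pi> ! k))"
    by (subst sum.swap) simp
  finally show ?thesis
    by (simp add: inner_dim_def proj_vec_def)
qed

lemma bij_id_proj: "bij_betw ((!) (id_proj :: ('d::{finite, linorder}) list)) {..<length (id_proj :: 'd list)} UNIV"
  unfolding id_proj_def by (rule bij_betw_nth) auto

lemma all_id_proj:
  fixes P :: "'d::{finite, linorder} \<Rightarrow> bool"
  shows "(\<forall>i. P i) \<longleftrightarrow> (\<forall>k<length (id_proj :: 'd list). P (id_proj ! k))"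
  using bij_betw_imp_surj_on[OF bij_id_proj[where 'd='d]] by (metis UNIV_I imageE lessThan_iff)

lemma proj_adjoint_id_proj:
  assumes "k < length (id_proj :: ('d::{finite, linorder}) list)"
  shows "proj_adjoint (id_proj :: 'd list) t $ (id_proj ! k) = t k"
proof -
  have "(id_proj :: 'd list) ! l = id_proj ! k \<longleftrightarrow> l = k" if "l < length (id_proj :: 'd list)" for l
    using bij_id_proj[where 'd='d] assms that by (auto simp: bij_betw_def inj_on_def)
  then have "proj_adjoint (id_proj :: 'd list) t $ (id_proj ! k) = (\<Sum>l<length (id_proj :: 'd list). if l = k then t l else 0)"
    unfolding proj_adjoint_def vec_lambda_beta by (intro sum.cong refl) auto
  then show ?thesis using assms by simp
qed

lemma prod_proj_adjoint_id_proj: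
  fixes f :: "'d::{finite, linorder} \<Rightarrow> real \<Rightarrow> 'b::comm_monoid_mult"
  shows "(\<Prod>i\<in>UNIV. f i (proj_adjoint id_proj t $ i)) = (\<Prod>k<length (id_proj :: 'd list). f (id_proj ! k) (t k))"
  by (subst prod.reindex_bij_betw[OF bij_id_proj, symmetric]) (simp add: proj_adjoint_id_proj)

lemma prob_space_std_normal: "prob_space (std_normal k)"
  unfolding std_normal_def
  by (intro prob_space_PiM prob_space_normal_density) simp

lemma sets_std_normal [measurable_cong]: "sets (std_normal k) = sets (\<Pi>\<^sub>M i\<in>{..<k}. borel)"
  unfolding std_normal_def by (rule sets_PiM_cong) auto

lemma measurable_proj_adjoint [measurable]: "proj_adjoint \<pi> \<in> borel_measurable (std_normal (length \<pi>))"
proof -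
  have "(\<lambda>t. \<Sum>k<length \<pi>. if \<pi> ! k = i then t k else 0) \<in> borel_measurable (std_normal (length \<pi>))" for i
    by (intro borel_measurable_sum) (auto simp: measurable_cong_sets[OF sets_std_normal refl])
  then show ?thesis
    unfolding proj_adjoint_def by (subst borel_measurable_euclidean_space) (auto simp: Basis_vec_def inner_axis)
qed

text \<open>
  Taking the image of \<open>std_normal\<close> under the adjoint of the identity projection, which only renames the
  coordinates, lets statements about almost every argument \<open>t\<close> be read on \<open>real ^ 'd\<close>.
\<close>

definition std_gaussian :: "('d::{finite, linorder}) rvec measure" where
  "std_gaussian = distr (std_normal (length (id_proj :: 'd list))) borel (proj_adjoint id_proj)"

lemma sets_std_gaussian [simp, measurable_cong]: "sets std_gaussian = sets borel"
  by (simp add: std_gaussian_def)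

lemma space_std_gaussian [simp]: "space std_gaussian = UNIV"
  by (simp add: std_gaussian_def)

lemma prob_space_std_gaussian: "prob_space std_gaussian"
  unfolding std_gaussian_def
  by (intro prob_space.prob_space_distr prob_space_std_normal measurable_proj_adjoint)

lemma prod_measurable_vec:
  fixes f :: "'d::finite \<Rightarrow> real \<Rightarrow> 'b::{real_normed_field, second_countable_topology}"
  assumes [measurable]: "\<And>i. f i \<in> borel_measurable borel"
  shows "(\<lambda>x. \<Prod>i\<in>UNIV. f i (x $ i)) \<in> borel_measurable (borel :: 'd rvec measure)"
  by measurable

text \<open>
  Characteristic function and moments of the standard Gaussian are integrals of products of functions of one
  coordinate each, so they reduce to dimension one.
\<close>

lemma
  fixes f :: "'d::{finite, linorder} \<Rightarrow> real \<Rightarrow> 'b::{real_normed_field, banach, second_countable_topology}"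
  assumes meas: "\<And>i. f i \<in> borel_measurable borel" and int: "\<And>i. integrable std_normal_distribution (f i)"
  shows integral_std_gaussian_prod: "(\<integral>x. (\<Prod>i\<in>UNIV. f i (x $ i)) \<partial>std_gaussian) = (\<Prod>i\<in>UNIV. \<integral>y. f i y \<partial>std_normal_distribution)"
    and integrable_std_gaussian_prod: "integrable std_gaussian (\<lambda>x. \<Prod>i\<in>UNIV. f i (x $ i))"
proof -
  interpret product_sigma_finite "\<lambda>_::nat. std_normal_distribution"
    by (rule product_sigma_finite.intro, intro prob_space_imp_sigma_finite prob_space_normal_density) simp
  note prod_measurable_vec[OF meas, measurable]
  show "(\<integral>x. (\<Prod>i\<in>UNIV. f i (x $ i)) \<partial>std_gaussian) = (\<Prod>i\<in>UNIV. \<integral>y. f i y \<partial>std_normal_distribution)"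
    unfolding std_gaussian_def
    by (subst integral_distr) (auto simp: prod_proj_adjoint_id_proj std_normal_def product_integral_prod[OF _ int]
        prod.reindex_bij_betw[OF bij_id_proj, of "\<lambda>i. \<integral>y. f i y \<partial>std_normal_distribution"])
  show "integrable std_gaussian (\<lambda>x. \<Prod>i\<in>UNIV. f i (x $ i))"
    unfolding std_gaussian_def
    by (subst integrable_distr_eq) (auto simp: prod_proj_adjoint_id_proj std_normal_def intro!: product_integrable_prod int)
qed

text \<open>
  On an orthant both measures are products of the same one-dimensional normal probabilities.
\<close>

lemma std_gaussian_density:
  "(std_gaussian :: ('d::{finite, linorder}) rvec measure) =
    density lborel (\<lambda>z. ennreal (exp (- (1 / 2) * (z \<bullet> z)) / sqrt ((2 * pi) ^ CARD('d))))"
proof (rule measure_eqI_orthants)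
  interpret prob_space "std_gaussian :: 'd rvec measure" by (rule prob_space_std_gaussian)
  show "finite_measure (std_gaussian :: 'd rvec measure)" by unfold_locales
  interpret P: product_sigma_finite "\<lambda>_::nat. std_normal_distribution"
    by (rule product_sigma_finite.intro, intro prob_space_imp_sigma_finite prob_space_normal_density) simp
  fix a :: "'d rvec"
  have dens: "exp (- (1 / 2) * (z \<bullet> z)) / sqrt ((2 * pi) ^ CARD('d)) = (\<Prod>i\<in>UNIV. std_normal_density (z $ i))" for z :: "'d rvec"
    by (simp add: std_normal_density_def prod_dividef inner_vec_def exp_sum[symmetric] sum_negf sum_divide_distrib power2_eq_square real_sqrt_power real_sqrt_mult power_mult_distrib)
  have pre: "proj_adjoint id_proj -` {..a} \<inter> space (std_normal (length (id_proj :: 'd list)))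
      = (\<Pi>\<^sub>E k\<in>{..<length (id_proj :: 'd list)}. {..a $ (id_proj ! k)})"
  proof -
    have "proj_adjoint id_proj t \<le> a \<longleftrightarrow> (\<forall>k<length (id_proj :: 'd list). t k \<le> a $ (id_proj ! k))" for t
      by (simp add: less_eq_vec_def all_id_proj proj_adjoint_id_proj)
    then show ?thesis
      by (auto simp: std_normal_def space_PiM PiE_iff)
  qed
  have "emeasure std_gaussian {..a} = (\<Prod>k<length (id_proj :: 'd list). emeasure std_normal_distribution {..a $ (id_proj ! k)})"
    unfolding std_gaussian_def
    by (subst emeasure_distr) (simp_all add: pre, simp add: std_normal_def P.emeasure_PiM)
  also have "\<dots> = (\<Prod>i\<in>UNIV. emeasure std_normal_distribution {..a $ i})"
    by (rule prod.reindex_bij_betw[OF bij_id_proj])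
  also have "\<dots> = (\<Prod>i\<in>UNIV. \<integral>\<^sup>+y. ennreal (std_normal_density y) * indicator {..a $ i} y \<partial>lborel)"
    by (simp add: emeasure_density)
  also have "\<dots> = (\<integral>\<^sup>+z. (\<Prod>i\<in>UNIV. ennreal (std_normal_density (z $ i)) * indicator {..a $ i} (z $ i)) \<partial>lborel)"
    by (rule nn_integral_lborel_prod_vec[symmetric]) simp
  also have "\<dots> = (\<integral>\<^sup>+z. ennreal (\<Prod>i\<in>UNIV. std_normal_density (z $ i)) * indicator {..a} z \<partial>lborel)"
  proof (intro nn_integral_cong)
    fix z :: "'d rvec"
    have "(\<Prod>i\<in>UNIV. indicator {..a $ i} (z $ i)) = (indicator {..a} z :: ennreal)"
      by (auto simp: indicator_def less_eq_vec_def)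
    then show "(\<Prod>i\<in>UNIV. ennreal (std_normal_density (z $ i)) * indicator {..a $ i} (z $ i))
      = ennreal (\<Prod>i\<in>UNIV. std_normal_density (z $ i)) * indicator {..a} z"
      by (simp add: prod.distrib prod_ennreal)
  qed
  also have "\<dots> = emeasure (density lborel (\<lambda>z. ennreal (exp (- (1 / 2) * (z \<bullet> z)) / sqrt ((2 * pi) ^ CARD('d))))) {..a}"
    by (simp only: dens[symmetric]) (simp add: emeasure_density)
  finally show "emeasure std_gaussian {..a}
    = emeasure (density lborel (\<lambda>z. ennreal (exp (- (1 / 2) * (z \<bullet> z)) / sqrt ((2 * pi) ^ CARD('d))))) {..a}" .
qed simp_all

section \<open>Normal laws as affine images of the standard Gaussian\<close>

lemma matrix_inv_eqI:
  fixes A :: "'a::semiring_1^'n^'n"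
  assumes "A ** A' = mat 1" "A' ** A = mat 1"
  shows "matrix_inv A = A'"
proof -
  have "A ** matrix_inv A = mat 1 \<and> matrix_inv A ** A = mat 1"
    unfolding matrix_inv_def by (rule someI[of _ A']) (use assms in simp)
  then show ?thesis
    using assms by (metis matrix_mul_assoc matrix_mul_lid matrix_mul_rid)
qed

lemma inner_transpose_mult: "u \<bullet> (B *v z) = (transpose B *v u) \<bullet> z" for B :: "real^'n^'m"
  by (simp add: dot_lmul_matrix)

lemma continuous_on_matrix_vector_mult:
  fixes A :: "real^'n^'m"
  shows "continuous_on T f \<Longrightarrow> continuous_on T (\<lambda>x. A *v f x)"
  by (rule bounded_linear.continuous_on[OF matrix_vector_mul_bounded_linear])

text \<open>
  Substituting $x = m + B z$ turns the quadratic form of $S^{-1}$ at $x - m$ into $|z|^2$, and the factor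
  $|\det B| = \sqrt{\det S}$ of the substitution cancels the determinant in the normalizing constant.
\<close>

lemma normal_law_affine_image:
  fixes S B :: "('d::{finite, linorder}) rmat"
  assumes B: "invertible B" and S: "S = B ** transpose B"
  shows "normal_law m S = distr std_gaussian borel (\<lambda>z. m + B *v z)"
proof -
  obtain B' where B': "B ** B' = mat 1" "B' ** B = mat 1"
    using B by (auto simp: invertible_def)
  have tB': "transpose B ** transpose B' = mat 1" "transpose B' ** transpose B = mat 1"
    by (metis B' matrix_transpose_mul transpose_mat)+
  have inv: "matrix_inv S = transpose B' ** B'"
  proof (rule matrix_inv_eqI)
    have "S ** (transpose B' ** B') = B ** (transpose B ** transpose B') ** B'"
      by (simp add: S matrix_mul_assoc)
    then show "S ** (transpose B' ** B') = mat 1" by (simp add: tB' B')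
    have "(transpose B' ** B') ** S = transpose B' ** (B' ** B) ** transpose B"
      by (simp add: S matrix_mul_assoc)
    then show "(transpose B' ** B') ** S = mat 1" by (simp add: tB' B')
  qed
  have quad: "(matrix_inv S *v (B *v z)) \<bullet> (B *v z) = z \<bullet> z" for z
  proof -
    have "(matrix_inv S *v (B *v z)) \<bullet> (B *v z) = (transpose B *v (transpose B' *v (B' *v (B *v z)))) \<bullet> z"
      unfolding inv by (subst inner_transpose_mult) (simp only: matrix_vector_mul_assoc matrix_mul_assoc)
    also have "\<dots> = ((transpose B ** transpose B') *v ((B' ** B) *v z)) \<bullet> z"
      by (simp only: matrix_vector_mul_assoc matrix_mul_assoc)
    also have "\<dots> = z \<bullet> z" by (simp add: tB' B')
    finally show ?thesis .
  qed
  have det_nz: "det B \<noteq> 0" using B by (simp add: invertible_det_nz)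
  have det: "det S = (det B)\<^sup>2" by (simp add: S det_mul det_transpose power2_eq_square)
  define c where "c = sqrt ((2 * pi) ^ CARD('d))"
  have norm: "sqrt ((2 * pi) ^ CARD('d) * det S) = c * \<bar>det B\<bar>"
    by (simp add: c_def det real_sqrt_mult)
  define h where "h = (\<lambda>x. ennreal (exp (- (1 / 2) * ((matrix_inv S *v (x - m)) \<bullet> (x - m))) / (c * \<bar>det B\<bar>)))"
  have [measurable]: "h \<in> borel_measurable borel"
    unfolding h_def by (intro measurable_compose[OF _ measurable_ennreal] borel_measurable_continuous_onI continuous_intros continuous_on_matrix_vector_mult)
      (use det_nz in \<open>auto simp: c_def\<close>)
  have [measurable]: "(\<lambda>z. m + B *v z) \<in> borel_measurable borel"
    by (intro borel_measurable_continuous_onI continuous_intros continuous_on_matrix_vector_mult)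
  define g :: "'d rvec \<Rightarrow> ennreal" where "g z = ennreal (exp (- (1 / 2) * (z \<bullet> z)) / c)" for z
  have [measurable]: "g \<in> borel_measurable borel"
    unfolding g_def by measurable
  have hg: "ennreal \<bar>det B\<bar> * h (m + B *v z) = g z" for z
    using det_nz by (simp add: h_def g_def quad ennreal_mult'[symmetric])
  show ?thesis
  proof (rule measure_eqI)
    show "sets (normal_law m S) = sets (distr std_gaussian borel (\<lambda>z. m + B *v z))"
      by (simp add: normal_law_def)
    fix A assume "A \<in> sets (normal_law m S)"
    then have A [measurable]: "A \<in> sets borel" by (simp add: normal_law_def)
    have "emeasure (normal_law m S) A = (\<integral>\<^sup>+x. h x * indicator A x \<partial>lborel)"
      unfolding normal_law_def norm h_def[symmetric] by (simp add: emeasure_density)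
    also have "\<dots> = ennreal \<bar>det B\<bar> * (\<integral>\<^sup>+z. h (m + B *v z) * indicator A (m + B *v z) \<partial>lborel)"
      by (rule nn_integral_lborel_affine_invertible[OF B]) measurable
    also have "\<dots> = (\<integral>\<^sup>+z. ennreal \<bar>det B\<bar> * (h (m + B *v z) * indicator A (m + B *v z)) \<partial>lborel)"
      by (rule nn_integral_cmult[symmetric]) measurable
    also have "\<dots> = (\<integral>\<^sup>+z. g z * indicator A (m + B *v z) \<partial>lborel)"
      by (simp add: mult.assoc[symmetric] hg)
    also have "\<dots> = (\<integral>\<^sup>+z. g z * indicator ((\<lambda>z. m + B *v z) -` A) z \<partial>lborel)"
      by (simp add: indicator_vimage[symmetric] comp_def indicator_def)
    also have "\<dots> = emeasure (distr std_gaussian borel (\<lambda>z. m + B *v z)) A"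
    proof -
      have "(\<lambda>z. m + B *v z) -` A \<in> sets borel"
        using measurable_sets_borel[of "\<lambda>z. m + B *v z" borel A] by simp
      moreover have dens: "std_gaussian = density lborel g"
        unfolding g_def c_def by (rule std_gaussian_density)
      moreover have "(\<lambda>z. m + B *v z) \<in> borel_measurable std_gaussian"
        unfolding measurable_cong_sets[OF sets_std_gaussian refl] by measurable
      ultimately show ?thesis
        by (subst emeasure_distr) (simp_all add: emeasure_density dens[symmetric], simp add: dens emeasure_density)
    qed
    finally show "emeasure (normal_law m S) A = emeasure (distr std_gaussian borel (\<lambda>z. m + B *v z)) A" .
  qed
qed

lemma iexp_sum: "finite A \<Longrightarrow> iexp (\<Sum>i\<in>A. f i) = (\<Prod>i\<in>A. iexp (f i))"
  by (simp add: sum_distrib_left exp_sum)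

lemma cf_std_gaussian:
  fixes u :: "('d::{finite, linorder}) rvec"
  shows "(\<integral>z. iexp (u \<bullet> z) \<partial>std_gaussian) = complex_of_real (exp (- (1 / 2) * (u \<bullet> u)))"
proof -
  interpret N: real_distribution std_normal_distribution by (rule real_dist_normal_dist)
  have "(\<integral>z. iexp (u \<bullet> z) \<partial>std_gaussian) = (\<integral>z. (\<Prod>i\<in>UNIV. iexp (u $ i * z $ i)) \<partial>std_gaussian)"
    unfolding inner_vec_def by (subst iexp_sum) simp_all
  also have "\<dots> = (\<Prod>i\<in>UNIV. char std_normal_distribution (u $ i))"
    unfolding char_def by (rule integral_std_gaussian_prod[where f="\<lambda>i y. iexp (u $ i * y)"]) (auto intro!: N.integrable_iexp)
  also have "\<dots> = complex_of_real (exp (- (1 / 2) * (u \<bullet> u)))"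
    by (simp add: char_std_normal_distribution of_real_prod[symmetric] exp_sum[symmetric] inner_vec_def
        sum_negf sum_divide_distrib power2_eq_square del: of_real_prod)
  finally show ?thesis .
qed

lemma
  fixes m :: "('d::{finite, linorder}) rvec"
  assumes S: "pos_def S"
  shows prob_space_normal_law: "prob_space (normal_law m S)"
    and cf_normal_law: "(\<integral>x. iexp (u \<bullet> (x - m)) \<partial>normal_law m S) = complex_of_real (exp (- (1 / 2) * ((S *v u) \<bullet> u)))"
proof -
  obtain B :: "'d rmat" where B: "invertible B" "S = B ** transpose B"
    using pos_def_factorization[OF S] by blast
  note law = normal_law_affine_image[OF B]
  have meas [measurable]: "(\<lambda>z. m + B *v z) \<in> borel_measurable borel"
    by (intro borel_measurable_continuous_onI continuous_intros continuous_on_matrix_vector_mult)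
  have meas' [measurable]: "(\<lambda>z. m + B *v z) \<in> borel_measurable std_gaussian"
    using meas by (simp add: measurable_cong_sets[OF sets_std_gaussian refl])
  show "prob_space (normal_law m S)"
    unfolding law by (intro prob_space.prob_space_distr prob_space_std_gaussian meas')
  have "(\<integral>x. iexp (u \<bullet> (x - m)) \<partial>normal_law m S) = (\<integral>z. iexp (u \<bullet> (B *v z)) \<partial>std_gaussian)"
    unfolding law by (subst integral_distr) auto
  also have "\<dots> = complex_of_real (exp (- (1 / 2) * ((transpose B *v u) \<bullet> (transpose B *v u))))"
    using cf_std_gaussian[of "transpose B *v u"] by (simp only: inner_transpose_mult[of u B])
  also have "(transpose B *v u) \<bullet> (transpose B *v u) = (S *v u) \<bullet> u"
    unfolding B(2) by (subst inner_transpose_mult[symmetric]) (simp only: matrix_vector_mul_assoc inner_commute)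
  finally show "(\<integral>x. iexp (u \<bullet> (x - m)) \<partial>normal_law m S) = complex_of_real (exp (- (1 / 2) * ((S *v u) \<bullet> u)))" .
qed

text \<open>
  All these are integrals of monomials; a factor with exponent one makes the integral vanish.
\<close>

lemma std_gaussian_moments:
  fixes i j :: "'d::{finite, linorder}"
  shows "integrable std_gaussian (\<lambda>z :: 'd rvec. z $ i)" "(\<integral>z. z $ i \<partial>(std_gaussian :: 'd rvec measure)) = 0"
    and "integrable std_gaussian (\<lambda>z :: 'd rvec. z $ i * z $ j)"
    and "(\<integral>z. z $ i * z $ j \<partial>(std_gaussian :: 'd rvec measure)) = of_bool (i = j)"
proof -
  let ?N = std_normal_distribution
  have moment: "(\<integral>y. y ^ 0 \<partial>?N) = 1" "(\<integral>y. y ^ 1 \<partial>?N) = 0" "(\<integral>y. y ^ 2 \<partial>?N) = 1"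
    using std_normal_distribution_even_moments(1)[of 0] std_normal_distribution_even_moments(1)[of 1]
      integral_std_normal_distribution_moment_odd[of 1]
    by (simp_all add: fact_2)
  have int: "integrable ?N (\<lambda>y. y ^ n)" for n by (rule integrable_std_normal_distribution_moment)
  have one: "(\<Prod>k\<in>UNIV. (z $ k) ^ of_bool (k = i)) = z $ i" for z :: "'d rvec" and i
  proof -
    have "(\<Prod>k\<in>UNIV. (z $ k) ^ of_bool (k = i)) = (\<Prod>k\<in>UNIV. if k = i then z $ k else 1)"
      by (intro prod.cong) auto
    then show ?thesis by simp
  qed
  have two: "(\<Prod>k\<in>UNIV. (z $ k) ^ (of_bool (k = i) + of_bool (k = j))) = z $ i * z $ j" for z :: "'d rvec"
    by (simp only: power_add prod.distrib one)
  have int_pow: "integrable std_gaussian (\<lambda>z :: 'd rvec. \<Prod>k\<in>UNIV. (z $ k) ^ e k)"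
    and eq_pow: "(\<integral>z. (\<Prod>k\<in>UNIV. (z $ k) ^ e k) \<partial>(std_gaussian :: 'd rvec measure)) = (\<Prod>k\<in>UNIV. \<integral>y. y ^ e k \<partial>?N)"
    for e :: "'d \<Rightarrow> nat"
    using integrable_std_gaussian_prod[OF _ int[of "e _"]] integral_std_gaussian_prod[OF _ int[of "e _"]] by auto
  note int1 = int_pow[of "\<lambda>k. of_bool (k = i)"] and eq1 = eq_pow[of "\<lambda>k. of_bool (k = i)"]
  note int2 = int_pow[of "\<lambda>k. of_bool (k = i) + of_bool (k = j)"] and eq2 = eq_pow[of "\<lambda>k. of_bool (k = i) + of_bool (k = j)"]
  show "integrable std_gaussian (\<lambda>z :: 'd rvec. z $ i)" using int1 by (simp only: one)
  show "integrable std_gaussian (\<lambda>z :: 'd rvec. z $ i * z $ j)" using int2 by (simp only: two)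
  have "(\<Prod>k\<in>UNIV. \<integral>y. y ^ of_bool (k = i) \<partial>?N) = 0"
    using moment by (intro prod_zero) auto
  then show "(\<integral>z. z $ i \<partial>(std_gaussian :: 'd rvec measure)) = 0" using eq1 by (simp only: one)
  have "(\<Prod>k\<in>UNIV. \<integral>y. y ^ (of_bool (k = i) + of_bool (k = j)) \<partial>?N) = of_bool (i = j)"
  proof (cases "i = j")
    case True
    have "(\<integral>y. y ^ (of_bool (k = i) + of_bool (k = i)) \<partial>?N) = 1" for k
      using moment by (cases "k = i") (simp_all add: numeral_2_eq_2)
    then show ?thesis using True by (simp del: of_bool_eq_0_iff)
  next
    case False
    then show ?thesis
      using moment by (auto intro!: prod_zero bexI[of _ i])
  qed
  then show "(\<integral>z. z $ i * z $ j \<partial>(std_gaussian :: 'd rvec measure)) = of_bool (i = j)"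
    using eq2 by (simp only: two)
qed

lemma
  fixes m :: "('d::{finite, linorder}) rvec"
  assumes S: "pos_def S"
  shows normal_law_mean: "(\<integral>x. x $ i \<partial>normal_law m S) = m $ i"
    and normal_law_cov: "(\<integral>x. (x $ i - m $ i) * (x $ j - m $ j) \<partial>normal_law m S) = S $ i $ j"
proof -
  obtain B :: "'d rmat" where B: "invertible B" "S = B ** transpose B"
    using pos_def_factorization[OF S] by blast
  note law = normal_law_affine_image[OF B]
  interpret prob_space "std_gaussian :: 'd rvec measure" by (rule prob_space_std_gaussian)
  have meas: "(\<lambda>z. m + B *v z) \<in> borel_measurable std_gaussian"
    unfolding measurable_cong_sets[OF sets_std_gaussian refl]
    by (intro borel_measurable_continuous_onI continuous_intros continuous_on_matrix_vector_mult)
  note [simp] = std_gaussian_moments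
  have comp: "(m + B *v z) $ i = m $ i + (\<Sum>k\<in>UNIV. B $ i $ k * z $ k)" for z i
    by (simp add: matrix_vector_mult_def)
  show "(\<integral>x. x $ i \<partial>normal_law m S) = m $ i"
    unfolding law by (subst integral_distr[OF meas]) (simp_all add: comp prob_space[simplified] del: vector_add_component)
  have "(\<integral>x. (x $ i - m $ i) * (x $ j - m $ j) \<partial>normal_law m S)
      = (\<integral>z. (\<Sum>k\<in>UNIV. B $ i $ k * z $ k) * (\<Sum>l\<in>UNIV. B $ j $ l * z $ l) \<partial>std_gaussian)"
    unfolding law by (subst integral_distr[OF meas]) (simp_all add: comp del: vector_add_component)
  also have "\<dots> = (\<integral>z. (\<Sum>k\<in>UNIV. \<Sum>l\<in>UNIV. (B $ i $ k * B $ j $ l) * (z $ k * z $ l)) \<partial>std_gaussian)"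
    by (simp add: sum_product mult_ac)
  also have "\<dots> = (\<Sum>k\<in>UNIV. \<Sum>l\<in>UNIV. (B $ i $ k * B $ j $ l) * of_bool (k = l))"
    by simp
  also have "\<dots> = S $ i $ j"
    by (simp add: B(2) matrix_matrix_mult_def transpose_def of_bool_def if_distrib cong: if_cong)
  finally show "(\<integral>x. (x $ i - m $ i) * (x $ j - m $ j) \<partial>normal_law m S) = S $ i $ j" .
qed

section \<open>Uniqueness of characteristic functions\<close>

text \<open>
  After normalization the weight \<open>f\<close> is a probability density, and the weighted law of \<open>Y\<close> is a real
  distribution, to which the uniqueness theorem on the line applies.
\<close>

lemma cf_determines_weighted_law:
  fixes P Q :: "'b measure" and f Y :: "'b \<Rightarrow> real"
  assumes "finite_measure P" "finite_measure Q" and sets [measurable_cong]: "sets Q = sets P"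
    and [measurable]: "f \<in> borel_measurable P" "Y \<in> borel_measurable P"
    and f: "\<And>x. 0 \<le> f x" "\<And>x. f x \<le> C"
    and cf: "\<And>s. (\<integral>x. of_real (f x) * iexp (s * Y x) \<partial>P) = (\<integral>x. of_real (f x) * iexp (s * Y x) \<partial>Q)"
    and B [measurable]: "B \<in> sets borel"
  shows "(\<integral>x. f x * indicator B (Y x) \<partial>P) = (\<integral>x. f x * indicator B (Y x) \<partial>Q)"
proof -
  interpret P: finite_measure P by fact
  interpret Q: finite_measure Q by fact
  have intP: "integrable P f"
    using f by (intro P.integrable_const_bound[of _ C]) auto
  have intQ: "integrable Q f"
    using f by (intro Q.integrable_const_bound[of _ C]) auto
  define c where "c = (\<integral>x. f x \<partial>P)"
  have "complex_of_real c = complex_of_real (\<integral>x. f x \<partial>Q)"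
    using cf[of 0] by (simp add: c_def)
  then have cQ: "(\<integral>x. f x \<partial>Q) = c" by simp
  have "c \<ge> 0" unfolding c_def using f by simp
  \<comment> \<open>A weight of total mass 0 cannot be normalized.\<close>
  then consider "c = 0" | "c > 0" by linarith
  then show ?thesis
  proof cases
    case 1
    have "AE x in P. f x = 0" "AE x in Q. f x = 0"
      using 1 f integral_nonneg_eq_0_iff_AE[OF intP] integral_nonneg_eq_0_iff_AE[OF intQ] cQ
      by (auto simp: c_def)
    then have "(\<integral>x. f x * indicator B (Y x) \<partial>P) = 0" "(\<integral>x. f x * indicator B (Y x) \<partial>Q) = 0"
      by (auto intro!: integral_eq_zero_AE)
    then show ?thesis by simp
  next
    case 2
    define D where "D R = distr (density R (\<lambda>x. ennreal (f x / c))) borel Y" for R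
    have D: "real_distribution (D R)"
      "\<And>h :: real \<Rightarrow> complex. h \<in> borel_measurable borel \<Longrightarrow> (\<integral>y. h y \<partial>D R) = (\<integral>x. of_real (f x) * h (Y x) \<partial>R) / of_real c"
      "(\<integral>y. indicator B y \<partial>D R) = (\<integral>x. f x * indicator B (Y x) \<partial>R) / c"
      if [measurable_cong]: "sets R = sets P" and int: "integrable R f" and cR: "(\<integral>x. f x \<partial>R) = c" for R
    proof -
      have "(\<integral>\<^sup>+x. ennreal (f x / c) \<partial>R) = ennreal (\<integral>x. f x / c \<partial>R)"
        using int f 2 by (intro nn_integral_eq_integral) auto
      also have "\<dots> = 1" using 2 cR by simp
      finally have "prob_space (density R (\<lambda>x. ennreal (f x / c)))"
        by (intro prob_spaceI) (simp add: emeasure_density cong: nn_integral_cong)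
      then show "real_distribution (D R)"
        unfolding D_def real_distribution_def real_distribution_axioms_def
        by (auto intro!: prob_space.prob_space_distr)
      show "(\<integral>y. h y \<partial>D R) = (\<integral>x. of_real (f x) * h (Y x) \<partial>R) / of_real c"
        if [measurable]: "h \<in> borel_measurable borel" for h :: "real \<Rightarrow> complex"
      proof -
        have "(\<integral>y. h y \<partial>D R) = (\<integral>x. (f x / c) *\<^sub>R h (Y x) \<partial>R)"
          unfolding D_def using f 2 by (subst integral_distr) (auto intro!: integral_density)
        then show ?thesis
          by (simp add: scaleR_conv_of_real)
      qed
      have "(\<integral>y. indicator B y \<partial>D R) = (\<integral>x. (indicator B (Y x) :: real) \<partial>density R (\<lambda>x. ennreal (f x / c)))"
        unfolding D_def by (subst integral_distr) auto
      also have "\<dots> = (\<integral>x. (f x / c) *\<^sub>R (indicator B (Y x) :: real) \<partial>R)"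
        using f 2 by (intro integral_density) auto
      finally show "(\<integral>y. indicator B y \<partial>D R) = (\<integral>x. f x * indicator B (Y x) \<partial>R) / c"
        by simp
    qed
    have "D P = D Q"
    proof (rule Levy_uniqueness)
      show "real_distribution (D P)" "real_distribution (D Q)"
        using D(1) intP intQ cQ sets by (auto simp: c_def)
      show "char (D P) = char (D Q)"
        using cf intP intQ cQ sets by (auto simp: char_def fun_eq_iff D(2) c_def[symmetric])
    qed
    then have "(\<integral>x. f x * indicator B (Y x) \<partial>P) / c = (\<integral>x. f x * indicator B (Y x) \<partial>Q) / c"
      using D(3)[of P] D(3)[of Q] intP intQ cQ sets by (simp add: c_def)
    then show ?thesis using 2 by simp
  qed
qed

text \<open>
  The coordinates in \<open>J\<close> are replaced one after the other: a factor $\exp(i s x_k)$ in the argument becomes an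
  indicator of $x_k \in B_k$.  In the step, let $W$ be the product of the indicators for the indices in \<open>J\<close>
  and $\theta = \langle u, x\rangle$.  The one-dimensional uniqueness theorem needs nonnegative weights, so it is
  applied to $x_k$ under the weights $W (1 + \cos(\theta + c))$.  Their Fourier integrals are combinations of
  integrals known from the induction hypothesis, and the values $c = 0, \pi/2, \pi$ suffice to recover the real
  and imaginary parts of $W \exp(i \theta)$.
\<close>

lemma cf_determines_law_on_boxes:
  fixes P Q :: "(real^'n) measure" and B :: "'n \<Rightarrow> real set"
  assumes "finite_measure P" "finite_measure Q" and sets: "sets P = sets borel" "sets Q = sets borel"
    and cf: "\<And>u. (\<integral>x. iexp (u \<bullet> x) \<partial>P) = (\<integral>x. iexp (u \<bullet> x) \<partial>Q)"
    and B [measurable]: "\<And>i. B i \<in> sets borel"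
    and u: "\<And>i. i \<in> J \<Longrightarrow> u $ i = 0"
  shows "(\<integral>x. of_real (\<Prod>i\<in>J. indicator (B i) (x $ i)) * iexp (u \<bullet> x) \<partial>P)
    = (\<integral>x. of_real (\<Prod>i\<in>J. indicator (B i) (x $ i)) * iexp (u \<bullet> x) \<partial>Q)"
  using finite[of J] u
proof (induction J arbitrary: u rule: finite_induct)
  case empty
  then show ?case using cf by simp
next
  case (insert k J)
  note [measurable_cong] = sets
  define W :: "real^'n \<Rightarrow> real" where "W x = (\<Prod>i\<in>J. indicator (B i) (x $ i))" for x
  have W [measurable]: "W \<in> borel_measurable borel" unfolding W_def by measurable
  have W01: "0 \<le> W x" "W x \<le> 1" for x
    unfolding W_def by (auto intro!: prod_nonneg prod_le_1 simp: indicator_def)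
  define \<theta> where "\<theta> x = u \<bullet> x" for x
  have [measurable]: "\<theta> \<in> borel_measurable borel" unfolding \<theta>_def by measurable
  define V where "V x = W x * indicator (B k) (x $ k)" for x
  have V [measurable]: "V \<in> borel_measurable borel" unfolding V_def by measurable
  have V01: "\<bar>V x\<bar> \<le> 1" for x
    using W01[of x] by (auto simp: V_def indicator_def)
  have IH: "(\<integral>x. of_real (W x) * iexp (v \<bullet> x) \<partial>P) = (\<integral>x. of_real (W x) * iexp (v \<bullet> x) \<partial>Q)"
    if "\<And>i. i \<in> J \<Longrightarrow> v $ i = 0" for v
    using insert.IH[of v] that by (simp add: W_def)
  have int: "integrable R (\<lambda>x. of_real (W x) * iexp (v \<bullet> x))" "integrable R V"
      "integrable R (\<lambda>x. V x * cos (\<theta> x))" "integrable R (\<lambda>x. V x * sin (\<theta> x))"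
    if "R = P \<or> R = Q" for R v
  proof -
    interpret finite_measure R using that assms by auto
    have [measurable_cong]: "sets R = sets borel" using that sets by auto
    show "integrable R (\<lambda>x. of_real (W x) * iexp (v \<bullet> x))" "integrable R V"
      "integrable R (\<lambda>x. V x * cos (\<theta> x))" "integrable R (\<lambda>x. V x * sin (\<theta> x))"
      using W01 V01 by (auto intro!: integrable_const_bound[of _ 1] simp: norm_mult abs_mult mult_le_one abs_cos_le_one)
  qed
  have shifted: "(\<integral>x. W x * (1 + cos (\<theta> x + c)) * indicator (B k) (x $ k) \<partial>P)
      = (\<integral>x. W x * (1 + cos (\<theta> x + c)) * indicator (B k) (x $ k) \<partial>Q)" for c
  proof (rule cf_determines_weighted_law[where C=2])
    fix s
    have expand: "of_real (W x * (1 + cos (\<theta> x + c))) * iexp (s * x $ k)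
        = of_real (W x) * iexp ((s *\<^sub>R axis k 1) \<bullet> x)
          + (iexp c / 2) * (of_real (W x) * iexp ((u + s *\<^sub>R axis k 1) \<bullet> x))
          + (iexp (- c) / 2) * (of_real (W x) * iexp ((- u + s *\<^sub>R axis k 1) \<bullet> x))" for x
    proof -
      have "complex_of_real (cos y) = (iexp y + iexp (- y)) / 2" for y
        by (simp add: complex_eq_iff Re_exp Im_exp)
      moreover have add: "iexp (a + b) = iexp a * iexp b" for a b :: real
        by (simp add: distrib_left exp_add)
      moreover have "iexp (- (\<theta> x + c)) = iexp (- c) * iexp (- \<theta> x)"
      proof -
        have "- (\<theta> x + c) = - c + - \<theta> x" by simp
        then show ?thesis by (simp only: add)
      qed
      moreover have "iexp ((s *\<^sub>R axis k 1) \<bullet> x) = iexp (s * x $ k)"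
        "iexp ((u + s *\<^sub>R axis k 1) \<bullet> x) = iexp (\<theta> x) * iexp (s * x $ k)"
        "iexp ((- u + s *\<^sub>R axis k 1) \<bullet> x) = iexp (- \<theta> x) * iexp (s * x $ k)"
        by (simp_all add: \<theta>_def inner_add_left inner_axis' exp_add[symmetric] algebra_simps)
      ultimately show ?thesis
        by (simp only: of_real_mult of_real_add of_real_1) (simp add: field_simps)
    qed
    have zero: "(s *\<^sub>R axis k 1) $ i = 0" "(u + s *\<^sub>R axis k 1) $ i = 0" "(- u + s *\<^sub>R axis k 1) $ i = 0" if "i \<in> J" for i
      using that insert by (auto simp: axis_def)
    have "(\<integral>x. of_real (W x * (1 + cos (\<theta> x + c))) * iexp (s * x $ k) \<partial>R)
      = (\<integral>x. of_real (W x) * iexp ((s *\<^sub>R axis k 1) \<bullet> x) \<partial>R)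
          + (iexp c / 2) * (\<integral>x. of_real (W x) * iexp ((u + s *\<^sub>R axis k 1) \<bullet> x) \<partial>R)
          + (iexp (- c) / 2) * (\<integral>x. of_real (W x) * iexp ((- u + s *\<^sub>R axis k 1) \<bullet> x) \<partial>R)"
      if "R = P \<or> R = Q" for R
      unfolding expand
      by (subst Bochner_Integration.integral_add Bochner_Integration.integral_mult_right_zero
          | intro Bochner_Integration.integrable_add integrable_mult_right int(1) that refl)+
    then show "(\<integral>x. of_real (W x * (1 + cos (\<theta> x + c))) * iexp (s * x $ k) \<partial>P)
        = (\<integral>x. of_real (W x * (1 + cos (\<theta> x + c))) * iexp (s * x $ k) \<partial>Q)"
      using IH[OF zero(1)] IH[OF zero(2)] IH[OF zero(3)] by simp
  next
    fix x
    have pos: "0 \<le> 1 + cos (\<theta> x + c)"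
      using cos_ge_minus_one[of "\<theta> x + c"] by linarith
    with W01[of x] show "0 \<le> W x * (1 + cos (\<theta> x + c))"
      by simp
    have "W x * (1 + cos (\<theta> x + c)) \<le> 1 * 2"
      using W01[of x] cos_le_one[of "\<theta> x + c"] pos by (intro mult_mono) auto
    then show "W x * (1 + cos (\<theta> x + c)) \<le> 2" by simp
  qed (use assms in \<open>auto simp: measurable_cong_sets[OF sets(1) refl]\<close>)
  have parts: "(\<integral>x. W x * (1 + cos (\<theta> x + c)) * indicator (B k) (x $ k) \<partial>R)
      = (\<integral>x. V x \<partial>R) + cos c * (\<integral>x. V x * cos (\<theta> x) \<partial>R) - sin c * (\<integral>x. V x * sin (\<theta> x) \<partial>R)"
    if "R = P \<or> R = Q" for R c
  proof -
    have "W x * (1 + cos (\<theta> x + c)) * indicator (B k) (x $ k)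
        = V x + cos c * (V x * cos (\<theta> x)) - sin c * (V x * sin (\<theta> x))" for x
      by (simp add: V_def cos_add algebra_simps)
    then show ?thesis
      using int[OF that] by simp
  qed
  note combined = shifted[unfolded parts[OF disjI1, OF refl] parts[OF disjI2, OF refl]]
  have total: "(\<integral>x. V x \<partial>P) = (\<integral>x. V x \<partial>Q)"
    using combined[of 0] combined[of pi] by simp
  then have "(\<integral>x. V x * cos (\<theta> x) \<partial>P) = (\<integral>x. V x * cos (\<theta> x) \<partial>Q)"
    and "(\<integral>x. V x * sin (\<theta> x) \<partial>P) = (\<integral>x. V x * sin (\<theta> x) \<partial>Q)"
    using combined[of 0] combined[of "pi / 2"] by simp_all
  moreover have "(\<integral>x. of_real (\<Prod>i\<in>insert k J. indicator (B i) (x $ i)) * iexp (u \<bullet> x) \<partial>R)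
      = Complex (\<integral>x. V x * cos (\<theta> x) \<partial>R) (\<integral>x. V x * sin (\<theta> x) \<partial>R)" if "R = P \<or> R = Q" for R
  proof -
    have V_eq: "(\<Prod>i\<in>insert k J. indicator (B i) (x $ i)) = V x" for x
      using insert.hyps by (simp add: V_def W_def mult.commute)
    have "of_real (V x) * iexp (\<theta> x) = of_real (V x * cos (\<theta> x)) + \<i> * of_real (V x * sin (\<theta> x))" for x
      by (simp add: complex_eq_iff Re_exp Im_exp)
    then have "(\<integral>x. of_real (V x) * iexp (\<theta> x) \<partial>R)
        = of_real (\<integral>x. V x * cos (\<theta> x) \<partial>R) + \<i> * of_real (\<integral>x. V x * sin (\<theta> x) \<partial>R)"
      using int[OF that] by (simp del: of_real_mult)
    then show ?thesis
      by (simp only: V_eq \<theta>_def Complex_eq)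
  qed
  ultimately show ?case by simp
qed

text \<open>
  When all coordinates have been replaced, with half-lines for the sets, the integrals are the measures of
  orthants.
\<close>

lemma cf_uniqueness:
  fixes P Q :: "(real^'n) measure"
  assumes "finite_measure P" "finite_measure Q" and sets: "sets P = sets borel" "sets Q = sets borel"
    and cf: "\<And>u. (\<integral>x. iexp (u \<bullet> x) \<partial>P) = (\<integral>x. iexp (u \<bullet> x) \<partial>Q)"
  shows "P = Q"
proof (rule measure_eqI_orthants)
  interpret P: finite_measure P by fact
  interpret Q: finite_measure Q by fact
  note [measurable_cong] = sets
  fix a :: "real^'n"
  have ind: "(\<Prod>i\<in>UNIV. indicator {..a $ i} (x $ i)) = (indicator {..a} x :: real)" for x :: "real^'n"
    by (auto simp: indicator_def less_eq_vec_def)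
  have "complex_of_real (measure P {..a}) = complex_of_real (measure Q {..a})"
    using cf_determines_law_on_boxes[OF assms, of "\<lambda>i. {..a $ i}" UNIV 0] sets
    by (simp add: ind)
  then show "emeasure P {..a} = emeasure Q {..a}"
    by (simp add: P.emeasure_eq_measure Q.emeasure_eq_measure)
qed (use assms in auto)

section \<open>Masked vectors and mixtures over the cube\<close>

lemma inner_hadamard: "u \<bullet> (b * x) = (b * u) \<bullet> x" for u b x :: "real^'n"
  by (simp add: inner_vec_def mult_ac)

lemma borel_measurable_hadamard [measurable]:
  fixes f g :: "'a \<Rightarrow> real^'n"
  assumes [measurable]: "f \<in> borel_measurable M" "g \<in> borel_measurable M"
  shows "(\<lambda>x. f x * g x) \<in> borel_measurable M"
proof -
  have "continuous_on UNIV (\<lambda>x :: (real^'n) \<times> (real^'n). fst x * snd x)"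
    unfolding times_vec_def by (intro continuous_intros)
  from borel_measurable_continuous_Pair[OF assms this] show ?thesis by simp
qed

lemma continuous_on_hadamard_left:
  fixes b :: "real^'n"
  shows "continuous_on T f \<Longrightarrow> continuous_on T (\<lambda>x. b * f x)"
  unfolding times_vec_def by (intro continuous_intros)

lemma finite_cube: "finite (cube :: ('d::finite) rvec set)"
proof (rule finite_subset)
  show "(cube :: 'd rvec set) \<subseteq> range (\<lambda>A. \<chi> i. if i \<in> A then 1 else 0)"
  proof
    fix b :: "'d rvec" assume "b \<in> cube"
    then have "b = (\<chi> i. if i \<in> {i. b $ i = 1} then 1 else 0)"
      by (auto simp: cube_def vec_eq_iff)
    then show "b \<in> range (\<lambda>A. \<chi> i. if i \<in> A then 1 else 0)" by blast
  qed
qed simp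

lemma one_in_cube: "1 \<in> cube"
  by (simp add: cube_def)

lemma norm_hadamard_cube_le:
  assumes "b \<in> cube" shows "norm (b * x) \<le> norm x"
proof (rule norm_le_componentwise_cart)
  fix i show "norm ((b * x) $ i) \<le> norm (x $ i)"
    using assms by (cases "b $ i = 0") (auto simp: cube_def)
qed

lemma finite_coord_projs: "finite (coord_projs :: ('d::{finite, linorder}) list set)"
proof (rule finite_subset)
  show "(coord_projs :: 'd list set) \<subseteq> {\<pi>. set \<pi> \<subseteq> UNIV \<and> length \<pi> \<le> CARD('d)}"
  proof
    fix \<pi> :: "'d list" assume "\<pi> \<in> coord_projs"
    then have "distinct \<pi>" by (simp add: coord_projs_def strict_sorted_iff)
    then have "length \<pi> = card (set \<pi>)" by (simp add: distinct_card)
    also have "\<dots> \<le> CARD('d)" by (intro card_mono) auto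
    finally show "\<pi> \<in> {\<pi>. set \<pi> \<subseteq> UNIV \<and> length \<pi> \<le> CARD('d)}" by simp
  qed
qed (rule finite_lists_length_le, simp)

lemma id_proj_in_coord_projs: "(id_proj :: ('d::{finite, linorder}) list) \<in> coord_projs"
proof -
  have "set (id_proj :: 'd list) \<noteq> {}" by (simp add: id_proj_def)
  then show ?thesis
    by (auto simp: coord_projs_def id_proj_def strict_sorted_list_of_set)
qed

text \<open>
  The characteristic function of a masked centred normal vector on the full space; by \<open>normal_mixture_cf_eq\<close>
  every $\phi_\pi$ is its composition with the adjoint of $\pi$.
\<close>

definition gaussian_mixture_cf :: "('d::finite) rmat \<Rightarrow> ('d rvec \<Rightarrow> real) \<Rightarrow> 'd rvec \<Rightarrow> real" where
  "gaussian_mixture_cf S q u = (\<Sum>b\<in>cube. q b * exp (- (1 / 2) * ((S *v (b * u)) \<bullet> (b * u))))"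

lemma proj_quadratic_form:
  "inner_dim (length \<pi>) (mult_mv (length \<pi>) (diag_mat (proj_vec \<pi> b))
      (mult_mv (length \<pi>) (proj_mat \<pi> S) (mult_mv (length \<pi>) (diag_mat (proj_vec \<pi> b)) t))) t
    = (S *v (b * proj_adjoint \<pi> t)) \<bullet> (b * proj_adjoint \<pi> t)"
proof -
  let ?n = "length \<pi>"
  define s where "s k = b $ (\<pi> ! k) * t k" for k
  have adj: "b * proj_adjoint \<pi> t = proj_adjoint \<pi> s"
    by (auto simp: vec_eq_iff proj_adjoint_def s_def sum_distrib_left intro!: sum.cong)
  have inner: "proj_adjoint \<pi> s \<bullet> x = (\<Sum>k<?n. s k * x $ (\<pi> ! k))" for x
    unfolding inner_dim_proj_vec[symmetric] by (simp add: inner_dim_def proj_vec_def)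
  have entry: "mult_mv ?n A v k = (\<Sum>l<?n. A k l * v l)" if "k < ?n" for A v k
    using that by (simp add: mult_mv_def)
  have diag: "mult_mv ?n (diag_mat (proj_vec \<pi> b)) v k = b $ (\<pi> ! k) * v k" if "k < ?n" for v k
    using that by (simp add: entry diag_mat_def proj_vec_def if_distrib[of "\<lambda>y. y * _"] cong: if_cong)
  have "mult_mv ?n (proj_mat \<pi> S) (mult_mv ?n (diag_mat (proj_vec \<pi> b)) t) k = (S *v proj_adjoint \<pi> s) $ (\<pi> ! k)"
    if "k < ?n" for k
  proof -
    have "(S *v proj_adjoint \<pi> s) $ (\<pi> ! k) = proj_adjoint \<pi> s \<bullet> (S $ (\<pi> ! k))"
      by (simp add: matrix_vector_mult_def inner_vec_def mult.commute)
    also have "\<dots> = (\<Sum>l<?n. S $ (\<pi> ! k) $ (\<pi> ! l) * (b $ (\<pi> ! l) * t l))"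
      by (simp add: inner s_def mult_ac)
    also have "\<dots> = mult_mv ?n (proj_mat \<pi> S) (mult_mv ?n (diag_mat (proj_vec \<pi> b)) t) k"
      unfolding entry[OF that] by (intro sum.cong refl) (simp add: diag proj_mat_def)
    finally show ?thesis by simp
  qed
  then have "inner_dim ?n (mult_mv ?n (diag_mat (proj_vec \<pi> b))
      (mult_mv ?n (proj_mat \<pi> S) (mult_mv ?n (diag_mat (proj_vec \<pi> b)) t))) t
    = (\<Sum>k<?n. s k * (S *v proj_adjoint \<pi> s) $ (\<pi> ! k))"
    unfolding inner_dim_def by (intro sum.cong refl) (simp add: diag s_def mult_ac)
  also have "\<dots> = (S *v proj_adjoint \<pi> s) \<bullet> proj_adjoint \<pi> s"
    unfolding inner[symmetric] by (rule inner_commute)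
  finally show ?thesis by (simp add: adj)
qed

text \<open>
  The weight of a mask $a$ on the coordinates selected by $\pi$ is the total weight of the masks $b$ that
  project to $a$, so the sum over $a$ is a sum over all $b$ grouped by their projection.
\<close>

lemma normal_mixture_cf_eq:
  "normal_mixture_cf S q \<pi> t = complex_of_real (gaussian_mixture_cf S q (proj_adjoint \<pi> t))"
proof -
  let ?e = "\<lambda>a. exp (- (1 / 2) * inner_dim (length \<pi>) (mult_mv (length \<pi>) (diag_mat a)
      (mult_mv (length \<pi>) (proj_mat \<pi> S) (mult_mv (length \<pi>) (diag_mat a) t))) t)"
  have "proj_vec \<pi> ` cube \<subseteq> cube_dim (length \<pi>)"
    by (auto simp: proj_vec_def cube_def cube_dim_def split: if_splits)
  moreover have "finite (cube_dim (length \<pi>))"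
    unfolding cube_dim_def by (intro finite_PiE) auto
  ultimately have "(\<Sum>b\<in>cube. ?e (proj_vec \<pi> b) * q b)
      = (\<Sum>a\<in>cube_dim (length \<pi>). \<Sum>b | b \<in> cube \<and> proj_vec \<pi> b = a. ?e (proj_vec \<pi> b) * q b)"
    by (intro sum.group[symmetric] finite_cube)
  also have "\<dots> = (\<Sum>a\<in>cube_dim (length \<pi>). ?e a * proj_pmf \<pi> q a)"
    unfolding proj_pmf_def sum_distrib_left by (intro sum.cong refl) auto
  finally show ?thesis
    unfolding normal_mixture_cf_def gaussian_mixture_cf_def proj_quadratic_form by (simp add: mult.commute)
qed

text \<open>
  By induction on the number of ones of a mask $c$, $D(c \odot u) = 0$ for all $u$.  At the argument
  $c \odot u$ the masks $b$ with $b \odot c \ne c$ contribute 0 by induction, and the others contribute the same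
  value $D(c \odot u)$; their total weight is positive because it includes $p(\mathbf 1)$.  The case
  $c = \mathbf 1$ is the claim.
\<close>

lemma cube_mixture_injective:
  fixes D :: "('d::finite) rvec \<Rightarrow> complex" and p :: "'d rvec \<Rightarrow> real"
  assumes p: "\<And>b. 0 \<le> p b" "0 < p 1"
    and mix: "\<And>u. (\<Sum>b\<in>cube. of_real (p b) * D (b * u)) = 0"
  shows "D u = 0"
proof -
  have "D (c * u) = 0" if "c \<in> cube" for c
    using that
  proof (induction "card {i. c $ i = 1}" arbitrary: c rule: less_induct)
    case less
    let ?keep = "{b \<in> cube. b * c = c}"
    define s where "s = (\<Sum>b\<in>?keep. p b)"
    have lower: "D (b * (c * u)) = 0" if b: "b \<in> cube" "b * c \<noteq> c" for b
    proof -
      have bits: "b $ i = 0 \<or> b $ i = 1" "c $ i = 0 \<or> c $ i = 1" for i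
        using b(1) less.prems by (simp_all add: cube_def)
      have "(b * c) $ i \<in> {0, 1}" for i
        using bits[of i] by auto
      then have bc: "b * c \<in> cube" by (simp add: cube_def)
      obtain i where "(b * c) $ i \<noteq> c $ i" using b(2) by (auto simp: vec_eq_iff)
      then have "c $ i = 1" "(b * c) $ i \<noteq> 1" using bits[of i] by auto
      moreover have "{i. (b * c) $ i = 1} \<subseteq> {i. c $ i = 1}"
        using bits by (auto) (metis mult_zero_right zero_neq_one)
      ultimately have "{i. (b * c) $ i = 1} \<subset> {i. c $ i = 1}" by blast
      then have "card {i. (b * c) $ i = 1} < card {i. c $ i = 1}"
        by (intro psubset_card_mono) auto
      then have "D ((b * c) * u) = 0" using less.hyps bc by blast
      then show ?thesis by (simp add: mult.assoc)
    qed
    have "0 = (\<Sum>b\<in>cube. of_real (p b) * D (b * (c * u)))"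
      by (simp add: mix)
    also have "\<dots> = (\<Sum>b\<in>?keep. of_real (p b) * D (c * u))"
      using lower by (intro sum.mono_neutral_cong_right finite_cube) (auto simp: mult.assoc[symmetric])
    also have "\<dots> = of_real s * D (c * u)"
      by (simp add: s_def sum_distrib_right)
    finally have "s = 0 \<or> D (c * u) = 0" by simp
    moreover have "p 1 \<le> s"
      unfolding s_def using finite_cube p(1) one_in_cube by (intro member_le_sum) auto
    ultimately show ?case using p(2) by auto
  qed
  from this[OF one_in_cube] show ?thesis by simp
qed

text \<open>
  Conditioning on the value of the mask; the mask is moved to the argument, since
  $\langle u, b \odot y\rangle = \langle b \odot u, y\rangle$.
\<close>

lemma (in prob_space) cf_masked_vector:
  assumes I [measurable]: "I \<in> borel_measurable M" and Icube: "\<And>\<omega>. \<omega> \<in> space M \<Longrightarrow> I \<omega> \<in> cube"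
    and Y [measurable]: "Y \<in> borel_measurable M" and indep: "indep_var borel I borel Y"
  shows "(\<integral>\<omega>. iexp (u \<bullet> (I \<omega> * Y \<omega>)) \<partial>M)
    = (\<Sum>b\<in>cube. of_real (prob {\<omega> \<in> space M. I \<omega> = b}) * (\<integral>\<omega>. iexp ((b * u) \<bullet> Y \<omega>) \<partial>M))"
proof -
  define E where "E b y = iexp ((b * u) \<bullet> y)" for b y :: "real^'b"
  have [measurable]: "E b \<in> borel_measurable borel" for b
    unfolding E_def by measurable
  have normE: "norm (E b y) = 1" for b y by (simp add: E_def)
  have split: "iexp (u \<bullet> (I \<omega> * Y \<omega>)) = (\<Sum>b\<in>cube. indicator {b} (I \<omega>) * E b (Y \<omega>))" if "\<omega> \<in> space M" for \<omega>
  proof -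
    have "(\<Sum>b\<in>cube. indicator {b} (I \<omega>) * E b (Y \<omega>)) = (\<Sum>b\<in>cube. if b = I \<omega> then E (I \<omega>) (Y \<omega>) else 0)"
      by (intro sum.cong refl) (auto simp: indicator_def)
    then show ?thesis
      using Icube[OF that] by (simp add: finite_cube E_def inner_hadamard)
  qed
  have ind: "indep_var borel (\<lambda>\<omega>. indicator {b} (I \<omega>) :: complex) borel (\<lambda>\<omega>. E b (Y \<omega>))" for b
    using indep_var_compose[OF indep, of "indicator {b}" borel "E b" borel] by (simp add: comp_def)
  have int: "integrable M (\<lambda>\<omega>. indicator {b} (I \<omega>) :: complex)" "integrable M (\<lambda>\<omega>. E b (Y \<omega>))" for b
    by (auto intro!: integrable_const_bound[of _ 1] simp: normE indicator_def)
  have prod: "(\<integral>\<omega>. indicator {b} (I \<omega>) * E b (Y \<omega>) \<partial>M) = of_real (prob {\<omega> \<in> space M. I \<omega> = b}) * (\<integral>\<omega>. E b (Y \<omega>) \<partial>M)" for b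
  proof -
    have "(\<integral>\<omega>. (indicator {b} (I \<omega>) :: complex) \<partial>M) = (\<integral>\<omega>. indicator {\<omega> \<in> space M. I \<omega> = b} \<omega> \<partial>M)"
      by (intro Bochner_Integration.integral_cong refl) (auto simp: indicator_def)
    also have "\<dots> = (\<integral>\<omega>. complex_of_real (indicator {\<omega> \<in> space M. I \<omega> = b} \<omega>) \<partial>M)"
      by (intro Bochner_Integration.integral_cong refl) (auto simp: indicator_def)
    also have "\<dots> = of_real (prob {\<omega> \<in> space M. I \<omega> = b})"
      by (subst integral_complex_of_real) simp
    finally show ?thesis
      using indep_var_lebesgue_integral[OF ind int] by simp
  qed
  have "(\<integral>\<omega>. iexp (u \<bullet> (I \<omega> * Y \<omega>)) \<partial>M) = (\<integral>\<omega>. (\<Sum>b\<in>cube. indicator {b} (I \<omega>) * E b (Y \<omega>)) \<partial>M)"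
    by (intro Bochner_Integration.integral_cong refl split)
  also have "\<dots> = (\<Sum>b\<in>cube. \<integral>\<omega>. indicator {b} (I \<omega>) * E b (Y \<omega>) \<partial>M)"
    by (intro Bochner_Integration.integral_sum indep_var_integrable[OF ind int])
  finally show ?thesis unfolding prod unfolding E_def .
qed

section \<open>Almost sure limit of the test statistic\<close>

lemma continuous_gaussian_mixture_cf: "continuous_on UNIV (gaussian_mixture_cf S q)"
  unfolding gaussian_mixture_cf_def
  by (intro continuous_intros continuous_on_matrix_vector_mult continuous_on_hadamard_left)

lemma gaussian_mixture_cf_bounded:
  assumes "pos_semidef S" "pmf_on_cube q"
  shows "\<bar>gaussian_mixture_cf S q u\<bar> \<le> 1"
proof -
  have "\<bar>gaussian_mixture_cf S q u\<bar> \<le> (\<Sum>b\<in>cube. \<bar>q b * exp (- (1 / 2) * ((S *v (b * u)) \<bullet> (b * u)))\<bar>)"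
    unfolding gaussian_mixture_cf_def by (rule sum_abs)
  also have "\<dots> \<le> (\<Sum>b\<in>cube. q b)"
    using assms by (intro sum_mono) (auto simp: abs_mult pmf_on_cube_def pos_semidef_def intro!: mult_left_le)
  finally show ?thesis using assms by (simp add: pmf_on_cube_def)
qed

lemma gaussian_mixture_cf_tendsto:
  assumes S: "(\<lambda>n. S n) \<longlonglongrightarrow> \<Sigma>" and q: "\<And>b. b \<in> cube \<Longrightarrow> (\<lambda>n. q n b) \<longlonglongrightarrow> p b"
  shows "(\<lambda>n. gaussian_mixture_cf (S n) (q n) u) \<longlonglongrightarrow> gaussian_mixture_cf \<Sigma> p u"
proof -
  have "(\<lambda>n. S n *v v) \<longlonglongrightarrow> \<Sigma> *v v" for v
    unfolding matrix_vector_mult_def by (intro tendsto_intros S tendsto_vec_nth)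
  then show ?thesis
    unfolding gaussian_mixture_cf_def by (intro tendsto_intros q) auto
qed

text \<open>
  The masked observations \<open>b k * x k\<close> are the only parts of the vectors \<open>x k\<close> that enter, so the empirical
  characteristic function is a function of the observable pairs.
\<close>

lemma empirical_masked_cf_eq:
  "empirical_masked_cf n b x m \<pi> t = 1 / of_nat n * (\<Sum>k=1..n. iexp (proj_adjoint \<pi> t \<bullet> (b k * x k - b k * m)))"
  by (simp add: empirical_masked_cf_def inner_dim_proj_vec right_diff_distrib)

lemma masked_cf_eq: "masked_cf M I X m \<pi> t = (\<integral>\<omega>. iexp (proj_adjoint \<pi> t \<bullet> (I \<omega> * (X \<omega> - m))) \<partial>M)"
  by (simp add: masked_cf_def inner_dim_proj_vec)

lemma norm_iexp_diff_le: "cmod (iexp x - iexp y) \<le> \<bar>x - y\<bar>"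
proof -
  have "iexp x - iexp y = iexp y * (iexp (x - y) - 1)"
    by (simp add: right_diff_distrib exp_add[symmetric])
  then have "cmod (iexp x - iexp y) = cmod (iexp (x - y) - 1)"
    by (simp add: norm_mult)
  also have "\<dots> \<le> \<bar>x - y\<bar>"
    using iexp_approx1[of "x - y" 0] by simp
  finally show ?thesis .
qed

lemma empirical_masked_cf_recentre:
  assumes "\<And>k. k \<ge> 1 \<Longrightarrow> b k \<in> cube"
  shows "cmod (empirical_masked_cf n b x m \<pi> t - empirical_masked_cf n b x \<mu> \<pi> t) \<le> norm (proj_adjoint \<pi> t) * norm (m - \<mu>)"
proof -
  let ?u = "proj_adjoint \<pi> t"
  have summand: "cmod (iexp (?u \<bullet> (b k * x k - b k * m)) - iexp (?u \<bullet> (b k * x k - b k * \<mu>))) \<le> norm ?u * norm (m - \<mu>)"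
    if "k \<in> {1..n}" for k
  proof -
    have "cmod (iexp (?u \<bullet> (b k * x k - b k * m)) - iexp (?u \<bullet> (b k * x k - b k * \<mu>))) \<le> \<bar>?u \<bullet> (b k * (\<mu> - m))\<bar>"
      by (rule order_trans[OF norm_iexp_diff_le]) (simp add: inner_diff_right right_diff_distrib)
    also have "\<dots> \<le> norm ?u * norm (b k * (\<mu> - m))" by (rule Cauchy_Schwarz_ineq2)
    also have "\<dots> \<le> norm ?u * norm (m - \<mu>)"
      using that assms norm_hadamard_cube_le[of "b k" "\<mu> - m"] by (intro mult_left_mono) (auto simp: norm_minus_commute)
    finally show ?thesis .
  qed
  have "empirical_masked_cf n b x m \<pi> t - empirical_masked_cf n b x \<mu> \<pi> t
      = 1 / of_nat n * (\<Sum>k=1..n. iexp (?u \<bullet> (b k * x k - b k * m)) - iexp (?u \<bullet> (b k * x k - b k * \<mu>)))"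
    by (simp add: empirical_masked_cf_eq right_diff_distrib sum_subtractf diff_divide_distrib)
  then have "cmod (empirical_masked_cf n b x m \<pi> t - empirical_masked_cf n b x \<mu> \<pi> t)
      = 1 / real n * cmod (\<Sum>k=1..n. iexp (?u \<bullet> (b k * x k - b k * m)) - iexp (?u \<bullet> (b k * x k - b k * \<mu>)))"
    by (simp add: norm_mult norm_divide)
  also have "\<dots> \<le> 1 / real n * (\<Sum>k=1..n. norm ?u * norm (m - \<mu>))"
    by (intro mult_left_mono order_trans[OF norm_sum] sum_mono summand) auto
  also have "\<dots> \<le> norm ?u * norm (m - \<mu>)"
    by (cases "n = 0") simp_all
  finally show ?thesis .
qed

lemma empirical_masked_cf_bounded: "cmod (empirical_masked_cf n b x m \<pi> t) \<le> 1"
proof -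
  have "cmod (\<Sum>k=1..n. iexp (proj_adjoint \<pi> t \<bullet> (b k * x k - b k * m))) \<le> (\<Sum>k=1..n. 1)"
    by (intro order_trans[OF norm_sum] sum_mono) simp
  then show ?thesis
    unfolding empirical_masked_cf_eq by (cases "n = 0") (simp_all add: norm_mult norm_divide field_simps)
qed

text \<open>
  This is the deterministic part of the convergence, for a single realization of the sample and the estimators:
  the integrands converge almost everywhere and are bounded by $(1 + 1)^2 = 4$.
\<close>

lemma test_statistic_proj_tendsto:
  fixes b x :: "nat \<Rightarrow> ('d::finite) rvec"
  assumes b: "\<And>k. k \<ge> 1 \<Longrightarrow> b k \<in> cube"
    and m: "m \<longlonglongrightarrow> \<mu>" and S: "S \<longlonglongrightarrow> \<Sigma>" and q: "\<And>a. a \<in> cube \<Longrightarrow> (\<lambda>n. q n a) \<longlonglongrightarrow> p a"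
    and psd: "\<And>n. n \<ge> 1 \<Longrightarrow> pos_semidef (S n)" and pmf: "\<And>n. n \<ge> 1 \<Longrightarrow> pmf_on_cube (q n)"
    and \<phi> [measurable]: "\<phi> \<in> borel_measurable (std_normal (length \<pi>))"
    and emp: "AE t in std_normal (length \<pi>). (\<lambda>n. empirical_masked_cf n b x \<mu> \<pi> t) \<longlonglongrightarrow> \<phi> t"
  shows "(\<lambda>n. 1 / real n * test_statistic_proj n b x (m n) (S n) (q n) \<pi>)
    \<longlonglongrightarrow> (\<integral>t. (cmod (\<phi> t - normal_mixture_cf \<Sigma> p \<pi> t))\<^sup>2 \<partial>std_normal (length \<pi>))"
proof -
  let ?N = "std_normal (length \<pi>)"
  interpret N: prob_space ?N by (rule prob_space_std_normal)
  define f where "f n t = (cmod (empirical_masked_cf n b x (m n) \<pi> t - normal_mixture_cf (S n) (q n) \<pi> t))\<^sup>2" for n t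
  have [measurable]: "gaussian_mixture_cf A r \<in> borel_measurable borel" for A :: "'d rmat" and r
    by (intro borel_measurable_continuous_onI continuous_gaussian_mixture_cf)
  have mix [measurable]: "normal_mixture_cf A r \<pi> \<in> borel_measurable ?N" for A r
    unfolding normal_mixture_cf_eq[abs_def] by measurable
  have emp_meas [measurable]: "empirical_masked_cf n b x v \<pi> \<in> borel_measurable ?N" for n v
    unfolding empirical_masked_cf_eq[abs_def] by measurable
  \<comment> \<open>The index is shifted because the bounds on the estimators hold for nonempty samples only.\<close>
  have "(\<lambda>n. \<integral>t. f (Suc n) t \<partial>?N) \<longlonglongrightarrow> (\<integral>t. (cmod (\<phi> t - normal_mixture_cf \<Sigma> p \<pi> t))\<^sup>2 \<partial>?N)"
  proof (rule integral_dominated_convergence[where w="\<lambda>_. 4"])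
    show "AE t in ?N. norm (f (Suc n) t) \<le> 4" for n
    proof (rule AE_I2)
      fix t
      have "cmod (empirical_masked_cf (Suc n) b x (m (Suc n)) \<pi> t - normal_mixture_cf (S (Suc n)) (q (Suc n)) \<pi> t) \<le> 1 + 1"
        using empirical_masked_cf_bounded gaussian_mixture_cf_bounded[OF psd pmf, of "Suc n" "Suc n"]
        by (intro order_trans[OF norm_triangle_ineq4] add_mono) (simp_all add: normal_mixture_cf_eq)
      then have "f (Suc n) t \<le> (1 + 1)\<^sup>2"
        unfolding f_def by (intro power_mono) auto
      then show "norm (f (Suc n) t) \<le> 4"
        by (simp add: f_def)
    qed
    show "AE t in ?N. (\<lambda>n. f (Suc n) t) \<longlonglongrightarrow> (cmod (\<phi> t - normal_mixture_cf \<Sigma> p \<pi> t))\<^sup>2"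
      using emp
    proof eventually_elim
      case (elim t)
      have "(\<lambda>n. norm (proj_adjoint \<pi> t) * norm (m n - \<mu>)) \<longlonglongrightarrow> norm (proj_adjoint \<pi> t) * norm (\<mu> - \<mu>)"
        by (intro tendsto_intros m)
      then have bound_tendsto: "(\<lambda>n. norm (proj_adjoint \<pi> t) * norm (m n - \<mu>)) \<longlonglongrightarrow> 0" by simp
      have "\<forall>\<^sub>F n in sequentially. cmod (empirical_masked_cf n b x (m n) \<pi> t - empirical_masked_cf n b x \<mu> \<pi> t)
          \<le> norm (proj_adjoint \<pi> t) * norm (m n - \<mu>)"
        by (intro always_eventually allI empirical_masked_cf_recentre b)
      from Lim_null_comparison[OF this bound_tendsto]
      have "(\<lambda>n. empirical_masked_cf n b x (m n) \<pi> t - empirical_masked_cf n b x \<mu> \<pi> t) \<longlonglongrightarrow> 0" .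
      from tendsto_add[OF this elim]
      have "(\<lambda>n. empirical_masked_cf n b x (m n) \<pi> t) \<longlonglongrightarrow> \<phi> t" by simp
      moreover have "(\<lambda>n. normal_mixture_cf (S n) (q n) \<pi> t) \<longlonglongrightarrow> normal_mixture_cf \<Sigma> p \<pi> t"
        unfolding normal_mixture_cf_eq by (intro tendsto_intros gaussian_mixture_cf_tendsto S q)
      ultimately have "(\<lambda>n. f n t) \<longlonglongrightarrow> (cmod (\<phi> t - normal_mixture_cf \<Sigma> p \<pi> t))\<^sup>2"
        unfolding f_def by (intro tendsto_intros)
      then show ?case by (rule LIMSEQ_Suc)
    qed
  qed (auto simp: f_def)
  then have "(\<lambda>n. 1 / real (Suc n) * test_statistic_proj (Suc n) b x (m (Suc n)) (S (Suc n)) (q (Suc n)) \<pi>)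
    \<longlonglongrightarrow> (\<integral>t. (cmod (\<phi> t - normal_mixture_cf \<Sigma> p \<pi> t))\<^sup>2 \<partial>?N)"
    by (simp add: test_statistic_proj_def f_def)
  then show ?thesis by (rule LIMSEQ_imp_Suc)
qed

text \<open>
  The strong law at each fixed argument, followed by Fubini.
\<close>

lemma (in prob_space) empirical_masked_cf_converges:
  fixes I X :: "'a \<Rightarrow> ('d::finite) rvec"
  assumes [measurable]: "I \<in> borel_measurable M" "X \<in> borel_measurable M"
    and indep: "indep_vars (\<lambda>_. borel) (\<lambda>k \<omega>. (Is k \<omega>, Is k \<omega> * Xs k \<omega>)) {1..}"
    and distr: "\<And>k. k \<ge> 1 \<Longrightarrow> distr M borel (\<lambda>\<omega>. (Is k \<omega>, Is k \<omega> * Xs k \<omega>)) = distr M borel (\<lambda>\<omega>. (I \<omega>, I \<omega> * X \<omega>))"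
  shows "AE \<omega> in M. AE t in std_normal (length \<pi>).
      (\<lambda>n. empirical_masked_cf n (\<lambda>k. Is k \<omega>) (\<lambda>k. Xs k \<omega>) \<mu> \<pi> t) \<longlonglongrightarrow> masked_cf M I X \<mu> \<pi> t"
    and "masked_cf M I X \<mu> \<pi> \<in> borel_measurable (std_normal (length \<pi>))"
proof -
  let ?N = "std_normal (length \<pi>)"
  interpret N: prob_space ?N by (rule prob_space_std_normal)
  show meas [measurable]: "masked_cf M I X \<mu> \<pi> \<in> borel_measurable ?N"
    unfolding masked_cf_eq[abs_def] by measurable
  define F where "F u z = iexp (u \<bullet> (snd z - fst z * \<mu>))" for u and z :: "'d rvec \<times> 'd rvec"
  have F [measurable]: "(\<lambda>(u, z). F u z) \<in> borel_measurable (borel \<Otimes>\<^sub>M borel)"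
    unfolding F_def borel_prod[symmetric] by measurable
  have Fu: "F u \<in> borel_measurable borel" for u
    using measurable_Pair2[OF F, of u] by simp
  have pairs: "(\<lambda>\<omega>. (Is k \<omega>, Is k \<omega> * Xs k \<omega>)) \<in> borel_measurable M" if "k \<ge> 1" for k
    using indep that unfolding indep_vars_def by auto
  have target: "masked_cf M I X \<mu> \<pi> t = (\<integral>\<omega>. F (proj_adjoint \<pi> t) (I \<omega>, I \<omega> * X \<omega>) \<partial>M)" for t
    by (simp add: masked_cf_eq F_def right_diff_distrib)
  show "AE \<omega> in M. AE t in ?N. (\<lambda>n. empirical_masked_cf n (\<lambda>k. Is k \<omega>) (\<lambda>k. Xs k \<omega>) \<mu> \<pi> t) \<longlonglongrightarrow> masked_cf M I X \<mu> \<pi> t"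
  proof (rule AE_pointwise_limit_commute)
    show "sigma_finite_measure M" "sigma_finite_measure ?N" by unfold_locales
    fix n
    have "(\<lambda>(\<omega>, t). F (proj_adjoint \<pi> t) (Is k \<omega>, Is k \<omega> * Xs k \<omega>)) \<in> borel_measurable (M \<Otimes>\<^sub>M ?N)"
      if k: "k \<ge> 1" for k
    proof -
      have "(\<lambda>z. (proj_adjoint \<pi> (snd z), (Is k (fst z), Is k (fst z) * Xs k (fst z)))) \<in> M \<Otimes>\<^sub>M ?N \<rightarrow>\<^sub>M borel \<Otimes>\<^sub>M borel"
        by (intro measurable_Pair measurable_compose[OF measurable_snd measurable_proj_adjoint]
            measurable_compose[OF measurable_fst pairs[OF k]])
      from measurable_compose[OF this F] show ?thesis
        by (simp add: case_prod_unfold)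
    qed
    then have "(\<lambda>z. 1 / of_nat n * (\<Sum>k=1..n. F (proj_adjoint \<pi> (snd z)) (Is k (fst z), Is k (fst z) * Xs k (fst z))))
        \<in> borel_measurable (M \<Otimes>\<^sub>M ?N)"
      by (intro borel_measurable_times borel_measurable_const borel_measurable_sum) (simp add: case_prod_unfold)
    then show "(\<lambda>(\<omega>, t). empirical_masked_cf n (\<lambda>k. Is k \<omega>) (\<lambda>k. Xs k \<omega>) \<mu> \<pi> t) \<in> borel_measurable (M \<Otimes>\<^sub>M ?N)"
      by (simp add: empirical_masked_cf_eq F_def case_prod_unfold)
  next
    fix t
    have "AE \<omega> in M. (\<lambda>n. 1 / of_nat n * (\<Sum>k=1..n. F (proj_adjoint \<pi> t) (Is k \<omega>, Is k \<omega> * Xs k \<omega>)))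
        \<longlonglongrightarrow> (\<integral>\<omega>. F (proj_adjoint \<pi> t) (I \<omega>, I \<omega> * X \<omega>) \<partial>M)"
    proof (rule strong_law_bounded_iid_complex[OF indep distr])
      show "(\<lambda>\<omega>. (I \<omega>, I \<omega> * X \<omega>)) \<in> borel_measurable M"
        unfolding borel_prod[symmetric] by measurable
      show "F (proj_adjoint \<pi> t) \<in> borel_measurable borel" by (rule Fu)
      show "cmod (F (proj_adjoint \<pi> t) z) \<le> 1" for z by (simp add: F_def)
    qed
    then show "AE \<omega> in M. (\<lambda>n. empirical_masked_cf n (\<lambda>k. Is k \<omega>) (\<lambda>k. Xs k \<omega>) \<mu> \<pi> t) \<longlonglongrightarrow> masked_cf M I X \<mu> \<pi> t"
      by (simp add: empirical_masked_cf_eq target F_def)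
  qed (rule meas)
qed

section \<open>Normality and vanishing of the limit\<close>

lemma (in prob_space) continuous_cf:
  fixes Y :: "'a \<Rightarrow> real^'n"
  assumes [measurable]: "Y \<in> borel_measurable M"
  shows "continuous_on UNIV (\<lambda>u. \<integral>\<omega>. iexp (u \<bullet> Y \<omega>) \<partial>M)"
proof -
  have "(\<lambda>n. \<integral>\<omega>. iexp (v n \<bullet> Y \<omega>) \<partial>M) \<longlonglongrightarrow> (\<integral>\<omega>. iexp (u \<bullet> Y \<omega>) \<partial>M)" if "v \<longlonglongrightarrow> u" for v u
    by (rule integral_dominated_convergence[where w="\<lambda>_. 1"]) (auto intro!: tendsto_intros that)
  then show ?thesis
    by (auto simp: continuous_on_sequentially comp_def)
qed

text \<open>
  The standard Gaussian has a positive density, so the set where \<open>G\<close> does not vanish is open and negligible,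
  hence empty.
\<close>

lemma continuous_zero_of_AE_std_normal:
  fixes G :: "('d::{finite, linorder}) rvec \<Rightarrow> complex"
  assumes G: "continuous_on UNIV G"
    and zero: "AE t in std_normal (length (id_proj :: 'd list)). G (proj_adjoint id_proj t) = 0"
  shows "G u = 0"
proof (rule ccontr)
  assume "G u \<noteq> 0"
  have [measurable]: "G \<in> borel_measurable borel" by (rule borel_measurable_continuous_onI[OF G])
  have "AE x in std_gaussian. G x = 0"
    unfolding std_gaussian_def using zero by (subst AE_distr_iff) auto
  then have "AE x in lborel. G x = 0"
    unfolding std_gaussian_density by (subst (asm) AE_density) (auto simp: divide_pos_pos)
  then have "{x. G x \<noteq> 0} \<in> null_sets lborel"
    by (subst (asm) AE_iff_null) (auto simp: borel_open)
  then have "negligible {x. G x \<noteq> 0}"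
    by (simp add: negligible_iff_null_sets null_sets_completionI)
  moreover have "open {x. G x \<noteq> 0}"
    using G by (auto intro!: open_Collect_neq)
  ultimately show False
    using \<open>G u \<noteq> 0\<close> open_not_negligible by blast
qed

text \<open>
  Under the null hypothesis the family only asserts some parameters; this identifies them with the mean and the
  covariance matrix of \<open>X\<close>, which enter the statistic.
\<close>

lemma (in prob_space) normal_law_parameters:
  fixes X :: "'a \<Rightarrow> ('d::{finite, linorder}) rvec"
  assumes [measurable]: "X \<in> borel_measurable M" and int: "integrable M X"
    and S: "pos_def S" and law: "distr M borel X = normal_law m S"
  shows "(\<integral>\<omega>. X \<omega> \<partial>M) = m" "cov_matrix M X = S"
proof -
  have mean: "(\<integral>\<omega>. X \<omega> \<partial>M) $ i = m $ i" for i
  proof -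
    have "(\<integral>\<omega>. X \<omega> \<partial>M) $ i = (\<integral>\<omega>. X \<omega> $ i \<partial>M)"
      by (rule integral_bounded_linear[OF bounded_linear_vec_nth int, symmetric])
    also have "\<dots> = (\<integral>x. x $ i \<partial>distr M borel X)"
      by (subst integral_distr) auto
    also have "\<dots> = m $ i"
      unfolding law by (rule normal_law_mean[OF S])
    finally show ?thesis .
  qed
  then show eq: "(\<integral>\<omega>. X \<omega> \<partial>M) = m" by (simp add: vec_eq_iff)
  have "(\<integral>\<omega>. (X \<omega> $ i - m $ i) * (X \<omega> $ j - m $ j) \<partial>M) = S $ i $ j" for i j
  proof -
    have "(\<integral>\<omega>. (X \<omega> $ i - m $ i) * (X \<omega> $ j - m $ j) \<partial>M)
        = (\<integral>x. (x $ i - m $ i) * (x $ j - m $ j) \<partial>distr M borel X)"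
      by (subst integral_distr) auto
    then show ?thesis
      unfolding law by (simp only: normal_law_cov[OF S])
  qed
  then show "cov_matrix M X = S"
    by (simp add: cov_matrix_def eq vec_eq_iff)
qed

lemma (in prob_space) normal_law_iff_cf:
  fixes X :: "'a \<Rightarrow> ('d::{finite, linorder}) rvec"
  assumes [measurable]: "X \<in> borel_measurable M" and S: "pos_def S"
  shows "distr M borel X = normal_law m S \<longleftrightarrow>
    (\<forall>u. (\<integral>\<omega>. iexp (u \<bullet> (X \<omega> - m)) \<partial>M) = complex_of_real (exp (- (1 / 2) * ((S *v u) \<bullet> u))))"
proof
  assume law: "distr M borel X = normal_law m S"
  show "\<forall>u. (\<integral>\<omega>. iexp (u \<bullet> (X \<omega> - m)) \<partial>M) = complex_of_real (exp (- (1 / 2) * ((S *v u) \<bullet> u)))"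
  proof
    fix u
    have "(\<integral>\<omega>. iexp (u \<bullet> (X \<omega> - m)) \<partial>M) = (\<integral>x. iexp (u \<bullet> (x - m)) \<partial>distr M borel X)"
      by (subst integral_distr) auto
    then show "(\<integral>\<omega>. iexp (u \<bullet> (X \<omega> - m)) \<partial>M) = complex_of_real (exp (- (1 / 2) * ((S *v u) \<bullet> u)))"
      unfolding law cf_normal_law[OF S] .
  qed
next
  assume cf: "\<forall>u. (\<integral>\<omega>. iexp (u \<bullet> (X \<omega> - m)) \<partial>M) = complex_of_real (exp (- (1 / 2) * ((S *v u) \<bullet> u)))"
  interpret N: prob_space "normal_law m S" by (rule prob_space_normal_law[OF S])
  have sets [measurable_cong]: "sets (normal_law m S) = sets borel" by (simp add: normal_law_def)
  have shift: "iexp (u \<bullet> x) = iexp (u \<bullet> m) * iexp (u \<bullet> (x - m))" for u x :: "'d rvec"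
    by (simp add: inner_diff_right exp_add[symmetric] ring_distribs)
  show "distr M borel X = normal_law m S"
  proof (rule cf_uniqueness)
    show "finite_measure (distr M borel X)" "finite_measure (normal_law m S)"
      by (auto intro!: finite_measure_distr) unfold_locales
    fix u
    have "(\<integral>x. iexp (u \<bullet> x) \<partial>distr M borel X) = (\<integral>\<omega>. iexp (u \<bullet> X \<omega>) \<partial>M)"
      by (subst integral_distr) auto
    also have "\<dots> = iexp (u \<bullet> m) * (\<integral>\<omega>. iexp (u \<bullet> (X \<omega> - m)) \<partial>M)"
      unfolding integral_mult_right_zero[symmetric] by (simp only: shift[symmetric])
    also have "\<dots> = iexp (u \<bullet> m) * (\<integral>x. iexp (u \<bullet> (x - m)) \<partial>normal_law m S)"
      unfolding cf_normal_law[OF S] by (simp only: cf[rule_format])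
    also have "\<dots> = (\<integral>x. iexp (u \<bullet> x) \<partial>normal_law m S)"
      unfolding integral_mult_right_zero[symmetric] by (simp only: shift[symmetric])
    finally show "(\<integral>x. iexp (u \<bullet> x) \<partial>distr M borel X) = (\<integral>x. iexp (u \<bullet> x) \<partial>normal_law m S)" .
  qed (simp_all add: sets)
qed

theorem theorem2:
  fixes M :: "'a measure"
    and X I :: "'a \<Rightarrow> ('d :: {finite, linorder}) rvec"
    and Xs Is :: "nat \<Rightarrow> 'a \<Rightarrow> 'd rvec"
    and \<mu> :: "'d rvec" and \<Sigma> :: "'d rmat" and p :: "'d rvec \<Rightarrow> real"
    and mu_hat :: "nat \<Rightarrow> (nat \<Rightarrow> 'd rvec \<times> 'd rvec) \<Rightarrow> 'd rvec"
    and Sigma_hat :: "nat \<Rightarrow> (nat \<Rightarrow> 'd rvec \<times> 'd rvec) \<Rightarrow> 'd rmat"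
    and p_hat :: "nat \<Rightarrow> (nat \<Rightarrow> 'd rvec \<times> 'd rvec) \<Rightarrow> 'd rvec \<Rightarrow> real"
    and w :: "'d list \<Rightarrow> real"
    and T :: "nat \<Rightarrow> 'a \<Rightarrow> real" and \<kappa> :: real
  assumes "prob_space M"
    and "CARD('d) \<ge> 2"
    and "X \<in> borel_measurable M"
    and "integrable M (\<lambda>\<omega>. (norm (X \<omega>))\<^sup>2)"
    and "\<mu> = (\<integral>\<omega>. X \<omega> \<partial>M)"
    and "\<Sigma> = cov_matrix M X"
    and "pos_def \<Sigma>"
    and "I \<in> borel_measurable M"
    and "\<And>\<omega>. \<omega> \<in> space M \<Longrightarrow> I \<omega> \<in> cube"
    and "prob_space.indep_var M borel I borel X"
    and "\<And>a. p a = measure M {\<omega> \<in> space M. I \<omega> = a}"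
    and "p 1 > 0"
    and "\<And>k \<omega>. k \<ge> 1 \<Longrightarrow> \<omega> \<in> space M \<Longrightarrow> Is k \<omega> \<in> cube"
    and "prob_space.indep_vars M (\<lambda>_. borel) (\<lambda>k \<omega>. (Is k \<omega>, Is k \<omega> * Xs k \<omega>)) {1..}"
    and "\<And>k. k \<ge> 1 \<Longrightarrow>
           distr M borel (\<lambda>\<omega>. (Is k \<omega>, Is k \<omega> * Xs k \<omega>)) = distr M borel (\<lambda>\<omega>. (I \<omega>, I \<omega> * X \<omega>))"
    and "\<And>n. n \<ge> 1 \<Longrightarrow> mu_hat n \<in> borel_measurable (sample_space n)"
    and "\<And>n. n \<ge> 1 \<Longrightarrow> Sigma_hat n \<in> borel_measurable (sample_space n)"
    and "\<And>n s. n \<ge> 1 \<Longrightarrow> s \<in> space (sample_space n) \<Longrightarrow> pos_semidef (Sigma_hat n s)"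
    and "\<And>n a. n \<ge> 1 \<Longrightarrow> a \<in> cube \<Longrightarrow> (\<lambda>s. p_hat n s a) \<in> borel_measurable (sample_space n)"
    and "\<And>n s. n \<ge> 1 \<Longrightarrow> s \<in> space (sample_space n) \<Longrightarrow> pmf_on_cube (p_hat n s)"
    and "AE \<omega> in M. (\<lambda>n. mu_hat n (sample n Is Xs \<omega>)) \<longlonglongrightarrow> \<mu>"
    and "AE \<omega> in M. (\<lambda>n. Sigma_hat n (sample n Is Xs \<omega>)) \<longlonglongrightarrow> \<Sigma>"
    and "\<And>a. a \<in> cube \<Longrightarrow> AE \<omega> in M. (\<lambda>n. p_hat n (sample n Is Xs \<omega>) a) \<longlonglongrightarrow> p a"
    and "\<And>\<pi>. \<pi> \<in> coord_projs \<Longrightarrow> w \<pi> \<in> {0..1}"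
    and "(\<Sum>\<pi>\<in>coord_projs. w \<pi>) = 1"
    and "w id_proj > 0"
    and "\<And>n \<omega>. T n \<omega> = test_statistic w n (\<lambda>k. Is k \<omega>) (\<lambda>k. Xs k \<omega>)
           (mu_hat n (sample n Is Xs \<omega>)) (Sigma_hat n (sample n Is Xs \<omega>)) (p_hat n (sample n Is Xs \<omega>))"
    and "\<kappa> = (\<Sum>\<pi>\<in>coord_projs. w \<pi> *
           (\<integral>t. (cmod (masked_cf M I X \<mu> \<pi> t - normal_mixture_cf \<Sigma> p \<pi> t))\<^sup>2 \<partial>std_normal (length \<pi>)))"
  shows "(AE \<omega> in M. (\<lambda>n. 1 / real n * T n \<omega>) \<longlonglongrightarrow> \<kappa>)
    \<and> (\<forall>\<pi>\<in>coord_projs. integrable (std_normal (length \<pi>))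
          (\<lambda>t. (cmod (masked_cf M I X \<mu> \<pi> t - normal_mixture_cf \<Sigma> p \<pi> t))\<^sup>2))
    \<and> 0 \<le> \<kappa>
    \<and> (distr M borel X \<in> normal_family \<longrightarrow> \<kappa> = 0)
    \<and> (distr M borel X \<notin> normal_family \<longrightarrow> \<kappa> > 0)"
proof -
  interpret prob_space M by (rule assms(1))
  note [measurable] = assms(3) assms(8)
  note weight = assms(24) and kappa = assms(28)
  \<comment> \<open>\<open>D\<close> compares the characteristic functions of \<open>X\<close> and of the normal law, both centred; \<open>G\<close> compares those of the masked vectors.\<close>
  define D where "D u = (\<integral>\<omega>. iexp (u \<bullet> (X \<omega> - \<mu>)) \<partial>M) - complex_of_real (exp (- (1 / 2) * ((\<Sigma> *v u) \<bullet> u)))" for u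
  define G where "G u = (\<Sum>b\<in>cube. of_real (p b) * D (b * u))" for u
  let ?gap = "\<lambda>\<pi> t. masked_cf M I X \<mu> \<pi> t - normal_mixture_cf \<Sigma> p \<pi> t"
  have p_nonneg: "0 \<le> p b" for b
    by (simp add: assms(11))
  have contD: "continuous_on UNIV D"
    unfolding D_def by (intro continuous_intros continuous_cf continuous_on_matrix_vector_mult) measurable
  have contG: "continuous_on UNIV G"
    unfolding G_def
    by (intro continuous_intros continuous_on_compose2[OF contD] continuous_on_hadamard_left) auto
  have [measurable]: "G \<in> borel_measurable borel"
    by (rule borel_measurable_continuous_onI[OF contG])
  have gap: "?gap \<pi> t = G (proj_adjoint \<pi> t)" for \<pi> t
  proof -
    let ?u = "proj_adjoint \<pi> t"
    have "indep_var borel (id \<circ> I) borel ((\<lambda>x. x - \<mu>) \<circ> X)"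
      by (rule indep_var_compose[OF assms(10)]) auto
    then have "indep_var borel I borel (\<lambda>\<omega>. X \<omega> - \<mu>)"
      by (simp add: comp_def)
    then have "masked_cf M I X \<mu> \<pi> t = (\<Sum>b\<in>cube. of_real (p b) * (\<integral>\<omega>. iexp ((b * ?u) \<bullet> (X \<omega> - \<mu>)) \<partial>M))"
      unfolding masked_cf_eq assms(11) by (intro cf_masked_vector assms(9)) measurable
    moreover have "normal_mixture_cf \<Sigma> p \<pi> t
        = (\<Sum>b\<in>cube. of_real (p b) * complex_of_real (exp (- (1 / 2) * ((\<Sigma> *v (b * ?u)) \<bullet> (b * ?u)))))"
      unfolding normal_mixture_cf_eq gaussian_mixture_cf_def by simp
    ultimately show ?thesis
      unfolding G_def D_def by (simp only: right_diff_distrib sum_subtractf)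
  qed
  have D_bounded: "cmod (D u) \<le> 1 + 1" for u
  proof -
    have "cmod (\<integral>\<omega>. iexp (u \<bullet> (X \<omega> - \<mu>)) \<partial>M) \<le> (\<integral>\<omega>. cmod (iexp (u \<bullet> (X \<omega> - \<mu>))) \<partial>M)"
      by (rule integral_norm_bound)
    then have "cmod (\<integral>\<omega>. iexp (u \<bullet> (X \<omega> - \<mu>)) \<partial>M) \<le> 1"
      by (simp add: prob_space)
    moreover have "0 \<le> (\<Sigma> *v u) \<bullet> u"
      using assms(7) by (cases "u = 0") (auto simp: pos_def_def less_imp_le)
    ultimately show ?thesis
      unfolding D_def by (intro order_trans[OF norm_triangle_ineq4] add_mono) simp_all
  qed
  have G_bounded: "cmod (G u) \<le> (\<Sum>b\<in>cube. p b * 2)" for u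
    unfolding G_def using D_bounded p_nonneg
    by (intro order_trans[OF norm_sum] sum_mono) (simp add: norm_mult mult_left_mono)
  have integrable_gap: "integrable (std_normal (length \<pi>)) (\<lambda>t. (cmod (?gap \<pi> t))\<^sup>2)" for \<pi>
  proof -
    interpret N: prob_space "std_normal (length \<pi>)" by (rule prob_space_std_normal)
    show ?thesis
      unfolding gap
      by (rule N.integrable_const_bound[where B="(\<Sum>b\<in>cube. p b * 2)\<^sup>2"]) (auto intro!: power_mono G_bounded)
  qed
  have gap_nonneg: "0 \<le> (\<integral>t. (cmod (?gap \<pi> t))\<^sup>2 \<partial>std_normal (length \<pi>))" for \<pi>
    by (intro Bochner_Integration.integral_nonneg) simp
  have kappa_nonneg: "0 \<le> \<kappa>"
    unfolding kappa using weight by (intro sum_nonneg mult_nonneg_nonneg gap_nonneg) auto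

  have limit: "AE \<omega> in M. (\<lambda>n. 1 / real n * T n \<omega>) \<longlonglongrightarrow> \<kappa>"
  proof -
    have emp: "AE \<omega> in M. \<forall>\<pi>\<in>coord_projs. AE t in std_normal (length \<pi>).
        (\<lambda>n. empirical_masked_cf n (\<lambda>k. Is k \<omega>) (\<lambda>k. Xs k \<omega>) \<mu> \<pi> t) \<longlonglongrightarrow> masked_cf M I X \<mu> \<pi> t"
      by (intro AE_finite_allI finite_coord_projs empirical_masked_cf_converges(1)[OF assms(8,3,14,15)])
    have p_lim: "AE \<omega> in M. \<forall>a\<in>cube. (\<lambda>n. p_hat n (sample n Is Xs \<omega>) a) \<longlonglongrightarrow> p a"
      by (intro AE_finite_allI finite_cube assms)
    from emp p_lim assms(21,22) AE_space show ?thesis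
    proof eventually_elim
      case (elim \<omega>)
      have sample: "sample n Is Xs \<omega> \<in> space (sample_space n)" for n
        using assms(13) elim
        by (auto simp: sample_def sample_space_def space_PiM obs_space_def space_restrict_space)
      have "(\<lambda>n. \<Sum>\<pi>\<in>coord_projs. w \<pi> * (1 / real n * test_statistic_proj n (\<lambda>k. Is k \<omega>) (\<lambda>k. Xs k \<omega>)
          (mu_hat n (sample n Is Xs \<omega>)) (Sigma_hat n (sample n Is Xs \<omega>)) (p_hat n (sample n Is Xs \<omega>)) \<pi>)) \<longlonglongrightarrow> \<kappa>"
        unfolding kappa
      proof (intro tendsto_sum tendsto_mult tendsto_const test_statistic_proj_tendsto)
        show "masked_cf M I X \<mu> \<pi> \<in> borel_measurable (std_normal (length \<pi>))" for \<pi>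
          by (rule empirical_masked_cf_converges(2)[OF assms(8,3,14,15)])
      qed (use elim assms(13) sample assms(18,20) in auto)
      then show ?case
        by (simp add: assms(27) test_statistic_def sum_distrib_left mult_ac)
    qed
  qed

  have null: "\<kappa> = 0" if "distr M borel X \<in> normal_family"
  proof -
    obtain m S where S: "pos_def S" and law: "distr M borel X = normal_law m S"
      using \<open>distr M borel X \<in> normal_family\<close> by (auto simp: normal_family_def)
    have int: "integrable M X"
    proof (rule Bochner_Integration.integrable_bound[OF Bochner_Integration.integrable_add[OF integrable_const[of 1] assms(4)]])
      show "AE \<omega> in M. norm (X \<omega>) \<le> norm (1 + (norm (X \<omega>))\<^sup>2)"
      proof (rule AE_I2)
        fix \<omega>
        have "0 \<le> (norm (X \<omega>) - 1)\<^sup>2" by simp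
        then have "2 * norm (X \<omega>) \<le> (norm (X \<omega>))\<^sup>2 + 1" by (simp add: power2_diff)
        then have "norm (X \<omega>) \<le> 1 + (norm (X \<omega>))\<^sup>2"
          using norm_ge_zero[of "X \<omega>"] by linarith
        then show "norm (X \<omega>) \<le> norm (1 + (norm (X \<omega>))\<^sup>2)" by simp
      qed
    qed measurable
    have "\<mu> = m" "\<Sigma> = S"
      using normal_law_parameters[OF assms(3) int S law] assms(5,6) by simp_all
    then have "D u = 0" for u
      using normal_law_iff_cf[OF assms(3) S, of m] law by (simp add: D_def)
    then show ?thesis
      unfolding kappa gap G_def by simp
  qed

  have alternative: "\<kappa> > 0" if "distr M borel X \<notin> normal_family"
  proof (rule ccontr)
    assume "\<not> \<kappa> > 0"
    then have "\<kappa> = 0" using kappa_nonneg by simp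
    then have "w id_proj * (\<integral>t. (cmod (?gap id_proj t))\<^sup>2 \<partial>std_normal (length (id_proj :: 'd list))) = 0"
      unfolding kappa using weight gap_nonneg id_proj_in_coord_projs
      by (subst (asm) sum_nonneg_eq_0_iff) (auto simp: finite_coord_projs)
    then have "(\<integral>t. (cmod (?gap id_proj t))\<^sup>2 \<partial>std_normal (length (id_proj :: 'd list))) = 0"
      using assms(26) by simp
    then have "AE t in std_normal (length (id_proj :: 'd list)). (cmod (?gap id_proj t))\<^sup>2 = 0"
      by (subst (asm) integral_nonneg_eq_0_iff_AE[OF integrable_gap]) auto
    then have "AE t in std_normal (length (id_proj :: 'd list)). G (proj_adjoint id_proj t) = 0"
      unfolding gap by simp
    then have "G u = 0" for u
      by (rule continuous_zero_of_AE_std_normal[OF contG])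
    then have "D u = 0" for u
      using cube_mixture_injective[of p D u] p_nonneg assms(12) by (simp add: G_def)
    then have "distr M borel X = normal_law \<mu> \<Sigma>"
      using normal_law_iff_cf[OF assms(3,7), of \<mu>] by (simp add: D_def)
    then show False
      using that assms(7) by (auto simp: normal_family_def)
  qed
  show ?thesis
    using limit integrable_gap kappa_nonneg null alternative by blast
qed

end
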